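(* Let $n\ge0$. A complete metric space $M$ is a strong $\mathrm{FAP}(n)$-space if and only if every point $z\in M$ has a neighborhood (with the restricted metric) which is a strong $\mathrm{FAP}(n)$-space.
   Context: $\mathbb I=[0,1]$. A metric space $M$ has $\mathrm{FAP}(k)$ if for every $\epsilon>0$, $m\ge0$ and map $g\colon\mathbb I^m\times\mathbb I^k\to M$ there is $g'\colon\mathbb I^m\times\mathbb I^k\to M$ $\epsilon$-homotopic to $g$ (there is a homotopy $h$ from $g$ to $g'$ with $\operatorname{diam}h(\{x\}\times\mathbb I)<\epsilon$ for all $x$) with $\dim g'(\{z\}\times\mathbb I^k)\le k$ for all $z\in\mathbb I^m$. $M$ is a strong $\mathrm{FAP}(n)$-space if $M\in\mathrm{FAP}(k)$ for every $0\le k\le n$. *)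

theory Defs
  imports "HOL-Analysis.Analysis"
begin

text \<open>The cube I^m, realised inside Euclidean_space m (functions nat => real vanishing
  from index m on, product topology), cut down to coordinates in [0,1].\<close>
definition Icube :: "nat \<Rightarrow> (nat \<Rightarrow> real) topology" where
  "Icube m = subtopology (Euclidean_space m) {x. \<forall>i<m. 0 \<le> x i \<and> x i \<le> 1}"

definition mdiam :: "'a metric \<Rightarrow> 'a set \<Rightarrow> real" where
  "mdiam M S = Sup {mdist M x y | x y. x \<in> S \<and> y \<in> S}"

definition covdim_le :: "'a topology \<Rightarrow> nat \<Rightarrow> bool" where
  "covdim_le X n \<longleftrightarrow>
     (\<forall>\<U>. finite \<U> \<and> (\<forall>U\<in>\<U>. openin X U) \<and> \<Union>\<U> = topspace X \<longrightarrow>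
        (\<exists>\<V>. finite \<V> \<and> (\<forall>V\<in>\<V>. openin X V) \<and> \<Union>\<V> = topspace X \<and>
             (\<forall>V\<in>\<V>. \<exists>U\<in>\<U>. V \<subseteq> U) \<and>
             (\<forall>x\<in>topspace X. card {V\<in>\<V>. x \<in> V} \<le> n + 1)))"

definition mdim_le :: "'a metric \<Rightarrow> 'a set \<Rightarrow> nat \<Rightarrow> bool" where
  "mdim_le M A k \<longleftrightarrow> covdim_le (subtopology (mtopology_of M) A) k"

definition FAP :: "nat \<Rightarrow> 'a metric \<Rightarrow> bool" where
  "FAP k M \<longleftrightarrow>
    (\<forall>\<epsilon>>0. \<forall>m. \<forall>g. continuous_map (prod_topology (Icube m) (Icube k)) (mtopology_of M) g \<longrightarrow>
       (\<exists>g' h. continuous_map (prod_topology (Icube m) (Icube k)) (mtopology_of M) g' \<and>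
          continuous_map (prod_topology (prod_topology (Icube m) (Icube k)) (top_of_set {0..1::real}))
                         (mtopology_of M) h \<and>
          (\<forall>x\<in>topspace (prod_topology (Icube m) (Icube k)).
              h (x, 0) = g x \<and> h (x, 1) = g' x \<and> mdiam M (h ` ({x} \<times> {0..1::real})) < \<epsilon>) \<and>
          (\<forall>z\<in>topspace (Icube m). mdim_le M (g' ` ({z} \<times> topspace (Icube k))) k)))"

definition strong_FAP :: "nat \<Rightarrow> 'a metric \<Rightarrow> bool" where
  "strong_FAP n M \<longleftrightarrow> (\<forall>k\<le>n. FAP k M)"

end

theory Submission
  imports Defs
begin

text \<open>Only the local-to-global direction needs work; it goes by induction on \<open>k\<close>.

  For compact sets, \<open>dim \<le> k\<close> means that for every \<open>\<epsilon>\<close> there is a finite open \<open>\<epsilon>\<close>-small cover of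
  order at most \<open>k + 1\<close>. For all fibres at once this is, for fixed \<open>\<epsilon>\<close>, an open condition on maps of a cube.
  By completeness an infinite concatenation of rapidly shrinking homotopies converges, so as in Baire's
  theorem countably many open conditions can be met simultaneously as soon as each of them can be met by
  arbitrarily small homotopies.

  Given \<open>FAP k\<close>, this first makes the images of all slices \<open>{z} \<times> {t. t i = s}\<close> of codimension one
  at most \<open>k\<close>-dimensional. Then the map is changed near finitely many points \<open>c\<close>, using \<open>FAP (k + 1)\<close> of a
  neighbourhood of the image of \<open>c\<close>; over \<open>z\<close> the change happens inside a cube around \<open>c\<close> which shrinks as \<open>z\<close>
  moves away from \<open>c\<close>. The image of a fibre then consists of finitely many compacta
  of dimension at most \<open>k + 1\<close> and of what happens near the faces of these cubes. The latter stays close to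
  finitely many of the slices, so it has small covers of order at most \<open>k + 1\<close>.\<close>

section \<open>Covering dimension of compact sets at a fixed scale\<close>

text \<open>The cover consists of sets open in \<open>M\<close> while its order is counted only at
  points of \<open>X\<close>; so the condition passes to subsets with the same cover. Size is
  measured by pairwise distances because the supremum \<open>mdiam\<close> carries no information on
  unbounded sets.\<close>

definition edim_le :: "'a metric \<Rightarrow> real \<Rightarrow> nat \<Rightarrow> 'a set \<Rightarrow> bool" where
  "edim_le M e k X \<longleftrightarrow>
     (\<exists>\<W>. finite \<W> \<and> (\<forall>W\<in>\<W>. openin (mtopology_of M) W \<and> (\<forall>x\<in>W. \<forall>y\<in>W. mdist M x y < e)) \<and>
          X \<subseteq> \<Union>\<W> \<and> (\<forall>x\<in>X. card {W\<in>\<W>. x \<in> W} \<le> k + 1))"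

lemma edim_leE:
  assumes "edim_le M e k X"
  obtains \<W> where "finite \<W>" "X \<subseteq> \<Union>\<W>" "\<And>W. W \<in> \<W> \<Longrightarrow> openin (mtopology_of M) W"
    "\<And>W x y. \<lbrakk>W \<in> \<W>; x \<in> W; y \<in> W\<rbrakk> \<Longrightarrow> mdist M x y < e"
    "\<And>x. x \<in> X \<Longrightarrow> card {W\<in>\<W>. x \<in> W} \<le> k + 1"
proof -
  obtain \<W> where "finite \<W> \<and> (\<forall>W\<in>\<W>. openin (mtopology_of M) W \<and> (\<forall>x\<in>W. \<forall>y\<in>W. mdist M x y < e)) \<and>
          X \<subseteq> \<Union>\<W> \<and> (\<forall>x\<in>X. card {W\<in>\<W>. x \<in> W} \<le> k + 1)"
    using assms unfolding edim_le_def by (elim exE)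
  then show thesis by (intro that) auto
qed

lemma edim_le_subset:
  assumes "edim_le M e k X" "Y \<subseteq> X"
  shows "edim_le M e k Y"
proof -
  obtain \<W> where "finite \<W>" "X \<subseteq> \<Union>\<W>" "\<And>W. W \<in> \<W> \<Longrightarrow> openin (mtopology_of M) W"
    "\<And>W x y. \<lbrakk>W \<in> \<W>; x \<in> W; y \<in> W\<rbrakk> \<Longrightarrow> mdist M x y < e"
    "\<And>x. x \<in> X \<Longrightarrow> card {W\<in>\<W>. x \<in> W} \<le> k + 1"
    by (fact edim_leE[OF assms(1)])
  then show ?thesis
    unfolding edim_le_def using assms(2) by (intro exI[of _ \<W>]) auto
qed

lemma edim_le_Suc:
  assumes "edim_le M e k X"
  shows "edim_le M e (Suc k) X"
proof -
  obtain \<W> where "finite \<W>" "X \<subseteq> \<Union>\<W>" "\<And>W. W \<in> \<W> \<Longrightarrow> openin (mtopology_of M) W"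
    "\<And>W x y. \<lbrakk>W \<in> \<W>; x \<in> W; y \<in> W\<rbrakk> \<Longrightarrow> mdist M x y < e"
    "\<And>x. x \<in> X \<Longrightarrow> card {W\<in>\<W>. x \<in> W} \<le> k + 1"
    by (fact edim_leE[OF assms(1)])
  then show ?thesis
    unfolding edim_le_def by (intro exI[of _ \<W>]) (auto intro: le_SucI)
qed

lemma edim_le_mono_eps:
  assumes "edim_le M e k X" "e \<le> e'"
  shows "edim_le M e' k X"
proof -
  obtain \<W> where "finite \<W>" "X \<subseteq> \<Union>\<W>" "\<And>W. W \<in> \<W> \<Longrightarrow> openin (mtopology_of M) W"
    "\<And>W x y. \<lbrakk>W \<in> \<W>; x \<in> W; y \<in> W\<rbrakk> \<Longrightarrow> mdist M x y < e"
    "\<And>x. x \<in> X \<Longrightarrow> card {W\<in>\<W>. x \<in> W} \<le> k + 1"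
    by (fact edim_leE[OF assms(1)])
  then show ?thesis
    unfolding edim_le_def using assms(2) by (intro exI[of _ \<W>]) fastforce
qed

text \<open>Bounds the order of a family indexed by another one: indices may merge under
  \<open>F\<close>, which can only lower the count.\<close>

lemma card_Collect_image_le:
  assumes "finite A" "{W \<in> F ` A. P W} \<subseteq> F ` B" "B \<subseteq> A" "card B \<le> n"
  shows "card {W \<in> F ` A. P W} \<le> n"
proof -
  have "finite B" using assms finite_subset by blast
  then have "card {W \<in> F ` A. P W} \<le> card (F ` B)"
    using assms by (intro card_mono) auto
  also have "\<dots> \<le> card B" using \<open>finite B\<close> card_image_le by blast
  finally show ?thesis using assms by linarith
qed

lemma compactin_lebesgue_number:
  assumes "compactin (mtopology_of M) S" "S \<subseteq> \<Union>\<C>" "\<And>U. U \<in> \<C> \<Longrightarrow> openin (mtopology_of M) U"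
  obtains e where "e > 0" "\<And>x. x \<in> S \<Longrightarrow> \<exists>U\<in>\<C>. mball_of M x e \<subseteq> U"
proof -
  interpret Metric_space "mspace M" "mdist M" by simp
  show thesis
    using lebesgue_number[of S \<C>] assms that
    unfolding mtopology_of_def mball_of_def by metis
qed

lemma compactin_finite_small_cover:
  assumes "compactin (mtopology_of M) X" "e > 0" "openin (mtopology_of M) N" "X \<subseteq> N"
  obtains \<V> where "finite \<V>" "X \<subseteq> \<Union>\<V>"
    "\<And>V. V \<in> \<V> \<Longrightarrow> openin (mtopology_of M) V \<and> V \<subseteq> N \<and> (\<forall>x\<in>V. \<forall>y\<in>V. mdist M x y < e)"
proof -
  interpret Metric_space "mspace M" "mdist M" by simp
  have XM: "X \<subseteq> mspace M"
    using compactin_subset_topspace[OF assms(1)] by simp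
  let ?U = "(\<lambda>x. mball x (e/2) \<inter> N) ` X"
  have "\<exists>\<F>. finite \<F> \<and> \<F> \<subseteq> ?U \<and> X \<subseteq> \<Union>\<F>"
  proof (rule compactinD[OF assms(1)])
    show "openin (mtopology_of M) U" if "U \<in> ?U" for U
      using that assms(3) by (auto simp: mtopology_of_def)
    show "X \<subseteq> \<Union>?U"
      using XM assms by force
  qed
  then obtain \<F> where F: "finite \<F>" "\<F> \<subseteq> ?U" "X \<subseteq> \<Union>\<F>" by blast
  show thesis
  proof (rule that[OF F(1,3)])
    fix V assume "V \<in> \<F>"
    then obtain x where x: "V = mball x (e/2) \<inter> N" "x \<in> X" using F by blast
    have "mdist M y z < e" if "y \<in> V" "z \<in> V" for y z
    proof -
      have "mdist M y z \<le> mdist M x y + mdist M x z"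
        using that x by (auto intro: triangle'')
      then show ?thesis using that x by auto
    qed
    then show "openin (mtopology_of M) V \<and> V \<subseteq> N \<and> (\<forall>x\<in>V. \<forall>y\<in>V. mdist M x y < e)"
      using x assms(3) by (auto simp: mtopology_of_def)
  qed
qed

text \<open>If a point lies in several thickened sets, then each of the corresponding original sets contains
  the (mutually close) witnesses in \<open>X\<close>; so the order of the family at any point of
  \<open>M\<close> is bounded by its order at some point of \<open>X\<close>.\<close>

lemma edim_le_thicken:
  assumes X: "compactin (mtopology_of M) X" and e: "edim_le M e k X"
  obtains \<W> where "finite \<W>" "X \<subseteq> \<Union>\<W>"
    "\<And>W. W \<in> \<W> \<Longrightarrow> openin (mtopology_of M) W \<and> (\<forall>x\<in>W. \<forall>y\<in>W. mdist M x y < e)"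
    "\<And>x. card {W\<in>\<W>. x \<in> W} \<le> k + 1"
proof -
  interpret Metric_space "mspace M" "mdist M" by simp
  have XM: "X \<subseteq> mspace M"
    using compactin_subset_topspace[OF X] by simp
  obtain \<U> where U: "finite \<U>" "X \<subseteq> \<Union>\<U>"
    "\<And>W. W \<in> \<U> \<Longrightarrow> openin (mtopology_of M) W" "\<And>W x y. \<lbrakk>W \<in> \<U>; x \<in> W; y \<in> W\<rbrakk> \<Longrightarrow> mdist M x y < e"
    "\<And>x. x \<in> X \<Longrightarrow> card {W\<in>\<U>. x \<in> W} \<le> k + 1"
    by (fact edim_leE[OF e])
  obtain l where l: "l > 0" "\<And>x. x \<in> X \<Longrightarrow> \<exists>U\<in>\<U>. mball_of M x l \<subseteq> U"
    using compactin_lebesgue_number[OF X U(2,3)] by blast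
  \<comment> \<open>The step from \<open>l/2\<close> to \<open>l\<close> makes two witnesses of one
    point interchangeable: they are less than \<open>l\<close> apart, so each lies in the
    \<open>l\<close>-ball of the other.\<close>
  define T where "T U = U \<inter> (\<Union>y\<in>{y\<in>X. mball y l \<subseteq> U}. mball y (l/2))" for U
  show thesis
  proof (rule that)
    show "finite (T ` \<U>)" using U by simp
    show "X \<subseteq> \<Union>(T ` \<U>)"
    proof
      fix x assume x: "x \<in> X"
      then obtain V where V: "V \<in> \<U>" "mball x l \<subseteq> V" using l by (auto simp: mball_of_def)
      have "x \<in> T V" unfolding T_def using x V l XM
        by (force simp: subset_iff)
      then show "x \<in> \<Union>(T ` \<U>)" using V by blast
    qed
    show "openin (mtopology_of M) W \<and> (\<forall>x\<in>W. \<forall>y\<in>W. mdist M x y < e)" if "W \<in> T ` \<U>" for W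
    proof -
      obtain V where V: "V \<in> \<U>" "W = T V" using \<open>W \<in> T ` \<U>\<close> by blast
      have "openin (mtopology_of M) (T V)"
        unfolding T_def using U(3)[OF V(1)]
        by (intro openin_Int openin_Union) (auto simp: mtopology_of_def)
      then show ?thesis using V U(4)[OF V(1)] by (simp add: T_def)
    qed
    show "card {W \<in> T ` \<U>. x \<in> W} \<le> k + 1" for x
    proof (cases "\<exists>V\<in>\<U>. x \<in> T V")
      case True
      then obtain V y where V: "V \<in> \<U>" "y \<in> X" "x \<in> mball y (l/2)"
        unfolding T_def by blast
      have "y \<in> V'" if V': "V' \<in> \<U>" "x \<in> T V'" for V'
      proof -
        obtain y' where y': "y' \<in> X" "mball y' l \<subseteq> V'" "x \<in> mball y' (l/2)"
          using V' unfolding T_def by blast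
        have "mdist M y' y \<le> mdist M y' x + mdist M y x"
          using y' V by (auto intro: triangle')
        then have "mdist M y' y < l" using y' V by auto
        then show ?thesis using y' V XM by (auto simp: subset_iff)
      qed
      then show ?thesis
        by (intro card_Collect_image_le[where B="{W \<in> \<U>. y \<in> W}"]) (use U V in auto)
    next
      case False
      then have "{W \<in> T ` \<U>. x \<in> W} = {}" by blast
      then show ?thesis by (metis card.empty le0)
    qed
  qed
qed

lemma mdim_le_refine:
  assumes d: "mdim_le M X k" and X: "X \<subseteq> mspace M" and U: "finite \<U>" "X \<subseteq> \<Union>\<U>"
    and op: "\<And>U. U \<in> \<U> \<Longrightarrow> openin (mtopology_of M) U"
  obtains \<V> where "finite \<V>" "\<Union>\<V> = X" "\<And>V. V \<in> \<V> \<Longrightarrow> openin (subtopology (mtopology_of M) X) V"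
    "\<And>V. V \<in> \<V> \<Longrightarrow> \<exists>U\<in>\<U>. V \<subseteq> U" "\<And>x. x \<in> X \<Longrightarrow> card {V\<in>\<V>. x \<in> V} \<le> k + 1"
proof -
  let ?X = "subtopology (mtopology_of M) X"
  have tX: "topspace ?X = X" using X by (simp add: inf.absorb2)
  have "\<exists>\<V>. finite \<V> \<and> (\<forall>V\<in>\<V>. openin ?X V) \<and> \<Union>\<V> = topspace ?X \<and>
             (\<forall>V\<in>\<V>. \<exists>U\<in>(\<lambda>U. U \<inter> X) ` \<U>. V \<subseteq> U) \<and>
             (\<forall>x\<in>topspace ?X. card {V\<in>\<V>. x \<in> V} \<le> k + 1)"
  proof (rule d[unfolded mdim_le_def covdim_le_def, rule_format], intro conjI ballI)
    show "finite ((\<lambda>U. U \<inter> X) ` \<U>)" using U by simp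
    show "openin ?X W" if "W \<in> (\<lambda>U. U \<inter> X) ` \<U>" for W
      using that op by (auto simp: openin_subtopology)
    show "\<Union> ((\<lambda>U. U \<inter> X) ` \<U>) = topspace ?X"
      unfolding tX using U(2) by blast
  qed
  then obtain \<V> where V: "finite \<V> \<and> (\<forall>V\<in>\<V>. openin ?X V) \<and> \<Union>\<V> = X \<and>
             (\<forall>V\<in>\<V>. \<exists>U\<in>(\<lambda>U. U \<inter> X) ` \<U>. V \<subseteq> U) \<and>
             (\<forall>x\<in>X. card {V\<in>\<V>. x \<in> V} \<le> k + 1)"
    unfolding tX by (elim exE)
  have "\<exists>U\<in>\<U>. V \<subseteq> U" if "V \<in> \<V>" for V
  proof -
    have "\<exists>U\<in>(\<lambda>U. U \<inter> X) ` \<U>. V \<subseteq> U" using V that by simp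
    then show ?thesis by blast
  qed
  with V show thesis by (intro that[of \<V>]) simp_all
qed

text \<open>Compactness gives a finite cover by small open sets; its trace on \<open>X\<close> is
  refined to the right order, and the relatively open members are extended to open sets of
  \<open>M\<close>, cut down so as to remain small.\<close>

lemma mdim_le_imp_edim_le:
  assumes X: "compactin (mtopology_of M) X" and d: "mdim_le M X k" and e: "e > 0"
  shows "edim_le M e k X"
proof -
  have XM: "X \<subseteq> topspace (mtopology_of M)"
    using compactin_subset_topspace[OF X] by simp
  obtain \<U> where U: "finite \<U>" "X \<subseteq> \<Union>\<U>"
    "\<And>V. V \<in> \<U> \<Longrightarrow> openin (mtopology_of M) V \<and> V \<subseteq> topspace (mtopology_of M) \<and> (\<forall>x\<in>V. \<forall>y\<in>V. mdist M x y < e)"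
    using compactin_finite_small_cover[OF X e openin_topspace XM] by metis
  let ?X = "subtopology (mtopology_of M) X"
  have tX: "topspace ?X = X" using XM by (simp add: inf.absorb2)
  obtain \<V> where V: "finite \<V>" "\<Union>\<V> = X" "\<And>V. V \<in> \<V> \<Longrightarrow> openin ?X V"
    "\<And>V. V \<in> \<V> \<Longrightarrow> \<exists>U\<in>\<U>. V \<subseteq> U" "\<And>x. x \<in> X \<Longrightarrow> card {V\<in>\<V>. x \<in> V} \<le> k + 1"
    by (rule mdim_le_refine[OF d _ U(1,2)]) (use XM U(3) in auto)
  have "\<exists>W. openin (mtopology_of M) W \<and> (\<forall>x\<in>W. \<forall>y\<in>W. mdist M x y < e) \<and> V = W \<inter> X" if v: "V \<in> \<V>" for V
  proof -
    obtain N where N: "openin (mtopology_of M) N" "V = N \<inter> X"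
      using V(3)[OF v] by (auto simp: openin_subtopology)
    obtain U' where U': "U' \<in> \<U>" "V \<subseteq> U'" using V(4)[OF v] by blast
    show ?thesis
      by (rule exI[of _ "N \<inter> U'"]) (use N U' U(3)[OF U'(1)] in auto)
  qed
  then obtain W where W: "\<And>V. V \<in> \<V> \<Longrightarrow> openin (mtopology_of M) (W V) \<and> (\<forall>x\<in>W V. \<forall>y\<in>W V. mdist M x y < e) \<and> V = W V \<inter> X"
    by metis
  have "card {Z \<in> W ` \<V>. x \<in> Z} \<le> k + 1" if "x \<in> X" for x
  proof (rule card_Collect_image_le[where B="{V\<in>\<V>. x \<in> V}"])
    show "{Z \<in> W ` \<V>. x \<in> Z} \<subseteq> W ` {V \<in> \<V>. x \<in> V}" using W that by blast
    show "card {V \<in> \<V>. x \<in> V} \<le> k + 1" using V(5) that .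
  qed (use V(1) in auto)
  moreover have "X \<subseteq> \<Union>(W ` \<V>)" using V(2) W by blast
  ultimately show ?thesis
    unfolding edim_le_def using W V(1) by (intro exI[of _ "W ` \<V>"]) auto
qed

text \<open>By a Lebesgue number, a cover of small enough mesh refines any given open cover of a
  compact set.\<close>

lemma edim_le_imp_mdim_le:
  assumes X: "compactin (mtopology_of M) X" and d: "\<And>e. e > 0 \<Longrightarrow> edim_le M e k X"
  shows "mdim_le M X k"
proof -
  have XM: "X \<subseteq> mspace M"
    using compactin_subset_topspace[OF X] by simp
  let ?X = "subtopology (mtopology_of M) X"
  have tX: "topspace ?X = X" using XM by (simp add: inf.absorb2)
  show ?thesis
    unfolding mdim_le_def covdim_le_def
  proof (intro allI impI)
    fix \<U> assume "finite \<U> \<and> (\<forall>U\<in>\<U>. openin ?X U) \<and> \<Union>\<U> = topspace ?X"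
    then have U: "finite \<U>" "\<And>U. U \<in> \<U> \<Longrightarrow> openin ?X U" "\<Union>\<U> = X" unfolding tX by auto
    then obtain N where N: "\<And>U. U \<in> \<U> \<Longrightarrow> openin (mtopology_of M) (N U) \<and> U = N U \<inter> X"
      unfolding openin_subtopology by metis
    obtain l where l: "l > 0" "\<And>x. x \<in> X \<Longrightarrow> \<exists>U\<in>N`\<U>. mball_of M x l \<subseteq> U"
    proof (rule compactin_lebesgue_number[OF X, of "N ` \<U>"])
      show "X \<subseteq> \<Union>(N ` \<U>)" using N U(3) by blast
    qed (use N in auto)
    obtain \<W> where W: "finite \<W>" "X \<subseteq> \<Union>\<W>"
      "\<And>W. W \<in> \<W> \<Longrightarrow> openin (mtopology_of M) W" "\<And>W x y. \<lbrakk>W \<in> \<W>; x \<in> W; y \<in> W\<rbrakk> \<Longrightarrow> mdist M x y < l"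
      "\<And>x. x \<in> X \<Longrightarrow> card {W\<in>\<W>. x \<in> W} \<le> k + 1"
      by (fact edim_leE[OF d[OF l(1)]])
    \<comment> \<open>Members missing \<open>X\<close> are dropped; each of the others contains a
      point of \<open>X\<close>, whose \<open>l\<close>-ball selects the set to refine.\<close>
    let ?V = "(\<lambda>W. W \<inter> X) ` {W\<in>\<W>. W \<inter> X \<noteq> {}}"
    show "\<exists>\<V>. finite \<V> \<and> (\<forall>V\<in>\<V>. openin ?X V) \<and> \<Union>\<V> = topspace ?X \<and>
             (\<forall>V\<in>\<V>. \<exists>U\<in>\<U>. V \<subseteq> U) \<and> (\<forall>x\<in>topspace ?X. card {V\<in>\<V>. x \<in> V} \<le> k + 1)"
      unfolding tX
    proof (intro exI conjI ballI)
      show "finite ?V" using W by simp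
      show "openin ?X V" if "V \<in> ?V" for V using that W(3) by (auto simp: openin_subtopology)
      show "\<Union>?V = X" using W(2) by blast
      show "\<exists>U\<in>\<U>. V \<subseteq> U" if v: "V \<in> ?V" for V
      proof -
        obtain W0 x where x: "W0 \<in> \<W>" "x \<in> W0" "x \<in> X" "V = W0 \<inter> X" using v by blast
        then obtain U where u: "U \<in> \<U>" "mball_of M x l \<subseteq> N U" using l by blast
        have "V \<subseteq> mball_of M x l"
          using x XM W(4) by (auto simp: mball_of_def Metric_space.in_mball)
        then show ?thesis using u N x by blast
      qed
      show "card {V \<in> ?V. x \<in> V} \<le> k + 1" if "x \<in> X" for x
      proof (rule card_Collect_image_le[where B="{W\<in>\<W>. x \<in> W}"])
        show "{W \<in> \<W>. x \<in> W} \<subseteq> {W \<in> \<W>. W \<inter> X \<noteq> {}}" using that by blast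
      qed (use W that in auto)
    qed
  qed
qed

text \<open>Only countably many scales matter, which is what makes a Baire argument
  applicable.\<close>

lemma edim_le_inverse_Suc_imp_mdim_le:
  assumes "compactin (mtopology_of M) X" "\<And>j. edim_le M (1 / Suc j) k X"
  shows "mdim_le M X k"
proof (rule edim_le_imp_mdim_le[OF assms(1)])
  fix e :: real assume "e > 0"
  then obtain j where "1 / Suc j < e" using nat_approx_posE by blast
  then show "edim_le M e k X" using edim_le_mono_eps[OF assms(2)] by (metis less_imp_le)
qed

text \<open>A cover of \<open>B\<close> at scale \<open>e\<close> is extended over \<open>A\<close>
  by small sets avoiding \<open>B\<close> and then corrected on \<open>A\<close> alone: off
  \<open>A\<close> its members are kept, on \<open>A\<close> they are replaced by a refinement of
  order at most \<open>k + 1\<close>. Refining an arbitrary cover takes the full dimension bound for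
  \<open>A\<close>, whereas one scale suffices for \<open>B\<close>.\<close>

lemma edim_le_Un:
  assumes A: "compactin (mtopology_of M) A" "mdim_le M A k"
      and B: "compactin (mtopology_of M) B" "edim_le M e k B" and e: "e > 0"
  shows "edim_le M e k (A \<union> B)"
proof -
  interpret Metric_space "mspace M" "mdist M" by simp
  have H: "Hausdorff_space (mtopology_of M)"
    by (simp add: Hausdorff_space_mtopology mtopology_of_def)
  have cA: "closedin (mtopology_of M) A" and cB: "closedin (mtopology_of M) B"
    using A B H compactin_imp_closedin by blast+
  have AM: "A \<subseteq> topspace (mtopology_of M)" and BM: "B \<subseteq> topspace (mtopology_of M)"
    using A B compactin_subset_topspace by blast+
  obtain \<W> where W: "finite \<W>" "B \<subseteq> \<Union>\<W>" "\<And>W. W \<in> \<W> \<Longrightarrow> openin (mtopology_of M) W"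
    "\<And>W x y. \<lbrakk>W \<in> \<W>; x \<in> W; y \<in> W\<rbrakk> \<Longrightarrow> mdist M x y < e"
    "\<And>x. x \<in> B \<Longrightarrow> card {W\<in>\<W>. x \<in> W} \<le> k + 1"
    by (fact edim_leE[OF B(2)])
  \<comment> \<open>What \<open>\<W>\<close> misses of \<open>A\<close> is compact and disjoint from
    \<open>B\<close>, so the additional sets \<open>\<V>\<close> can avoid \<open>B\<close> and
    leave the order at its points unchanged.\<close>
  have cAW: "compactin (mtopology_of M) (A - \<Union>\<W>)"
  proof (rule closed_compactin[OF A(1)])
    show "closedin (mtopology_of M) (A - \<Union> \<W>)"
      using cA W(3) by blast
  qed blast
  have "openin (mtopology_of M) (topspace (mtopology_of M) - B)" using cB by blast
  moreover have "A - \<Union>\<W> \<subseteq> topspace (mtopology_of M) - B" using W(2) AM by blast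
  ultimately obtain \<V> where V: "finite \<V>" "A - \<Union>\<W> \<subseteq> \<Union>\<V>"
    "\<And>V. V \<in> \<V> \<Longrightarrow> openin (mtopology_of M) V \<and> V \<subseteq> topspace (mtopology_of M) - B \<and> (\<forall>x\<in>V. \<forall>y\<in>V. mdist M x y < e)"
    using compactin_finite_small_cover[OF cAW e] by metis
  define \<U> where "\<U> = \<W> \<union> \<V>"
  have U: "finite \<U>" "A \<union> B \<subseteq> \<Union>\<U>" "\<And>U. U \<in> \<U> \<Longrightarrow> openin (mtopology_of M) U"
     "\<And>U x y. \<lbrakk>U \<in> \<U>; x \<in> U; y \<in> U\<rbrakk> \<Longrightarrow> mdist M x y < e"
    unfolding \<U>_def using W(1,2) V(1,2) by (blast, blast, use W(3) V(3) in blast, use W(4) V(3) in blast)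
  let ?A = "subtopology (mtopology_of M) A"
  have tA: "topspace ?A = A" using AM by (simp add: inf.absorb2)
  obtain \<R> where R: "finite \<R>" "\<Union>\<R> = A" "\<And>V. V \<in> \<R> \<Longrightarrow> openin ?A V"
    "\<And>V. V \<in> \<R> \<Longrightarrow> \<exists>U\<in>\<U>. V \<subseteq> U" "\<And>x. x \<in> A \<Longrightarrow> card {V\<in>\<R>. x \<in> V} \<le> k + 1"
    by (rule mdim_le_refine[OF A(2) _ U(1) _ U(3)]) (use AM U(2) in auto)
  obtain p where p: "\<And>V. V \<in> \<R> \<Longrightarrow> p V \<in> \<U> \<and> V \<subseteq> p V" using R(4) by metis
  \<comment> \<open>All refining sets assigned by \<open>p\<close> to the same \<open>U\<close> are
    merged; the result stays inside \<open>U\<close> and hence small.\<close>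
  define T where "T U = (U - A) \<union> \<Union>{V\<in>\<R>. p V = U}" for U
  have TU: "T U \<subseteq> U" for U unfolding T_def using p by blast
  have Topen: "openin (mtopology_of M) (T U)" if u: "U \<in> \<U>" for U
  proof -
    have "openin ?A (\<Union>{V\<in>\<R>. p V = U})" using R(3) by blast
    then obtain N where N: "openin (mtopology_of M) N" "\<Union>{V\<in>\<R>. p V = U} = N \<inter> A"
      by (auto simp: openin_subtopology)
    \<comment> \<open>The trace of \<open>T U\<close> on \<open>A\<close> is relatively open and
      \<open>A\<close> is closed, so this formula exhibits \<open>T U\<close> as open in
      \<open>M\<close>.\<close>
    have "T U = U \<inter> (N \<union> (topspace (mtopology_of M) - A))"
      using TU[of U] N(2) openin_subset[OF U(3)[OF u]] unfolding T_def by blast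
    then show ?thesis using N(1) U(3)[OF u] cA by (metis openin_Int openin_Un openin_diff openin_topspace)
  qed
  show ?thesis
    unfolding edim_le_def
  proof (intro exI conjI ballI)
    show "finite (T ` \<U>)" using U by simp
    show "openin (mtopology_of M) W" if "W \<in> T ` \<U>" for W using that Topen by blast
    show "mdist M x y < e" if "W \<in> T ` \<U>" "x \<in> W" "y \<in> W" for W x y
      using that U(4) TU by blast
    show "A \<union> B \<subseteq> \<Union> (T ` \<U>)"
    proof
      fix x assume x: "x \<in> A \<union> B"
      show "x \<in> \<Union> (T ` \<U>)"
      proof (cases "x \<in> A")
        case True
        then obtain V where "V \<in> \<R>" "x \<in> V" using R(2) by blast
        then show ?thesis using p unfolding T_def by blast
      next
        case False
        then show ?thesis using x U(2) unfolding T_def by blast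
      qed
    qed
    show "card {W \<in> T ` \<U>. x \<in> W} \<le> k + 1" if x: "x \<in> A \<union> B" for x
    proof (cases "x \<in> A")
      case True
      have *: "{W \<in> T ` \<U>. x \<in> W} \<subseteq> (\<lambda>V. T (p V)) ` {V\<in>\<R>. x \<in> V}"
        using True unfolding T_def by auto
      have "finite {V\<in>\<R>. x \<in> V}" using R by simp
      then have "card {W \<in> T ` \<U>. x \<in> W} \<le> card {V\<in>\<R>. x \<in> V}"
        using card_mono[OF _ *] card_image_le le_trans by blast
      then show ?thesis using R(5)[OF True] by linarith
    next
      case False
      then have xB: "x \<in> B" using x by blast
      show ?thesis
      proof (rule card_Collect_image_le[where B="{W\<in>\<W>. x \<in> W}"])
        show "{W \<in> T ` \<U>. x \<in> W} \<subseteq> T ` {W \<in> \<W>. x \<in> W}"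
        proof
          fix Z assume "Z \<in> {W \<in> T ` \<U>. x \<in> W}"
          then obtain U' where "U' \<in> \<U>" "Z = T U'" "x \<in> U'" using TU by blast
          moreover from this have "U' \<notin> \<V>" using V(3) xB by blast
          ultimately show "Z \<in> T ` {W \<in> \<W>. x \<in> W}" unfolding \<U>_def by blast
        qed
      qed (use U W(5)[OF xB] in \<open>auto simp: \<U>_def\<close>)
    qed
  qed
qed

lemma mdim_le_empty: "mdim_le M {} k"
  unfolding mdim_le_def covdim_le_def by (intro allI impI exI[of _ "{}"]) auto

lemma mdim_le_Un:
  assumes "compactin (mtopology_of M) A" "mdim_le M A k"
      and "compactin (mtopology_of M) B" "mdim_le M B k"
  shows "mdim_le M (A \<union> B) k"
  by (rule edim_le_imp_mdim_le) (auto intro: compactin_Un edim_le_Un mdim_le_imp_edim_le assms)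

lemma mdim_le_UN:
  assumes "finite J" "\<And>j. j \<in> J \<Longrightarrow> compactin (mtopology_of M) (A j) \<and> mdim_le M (A j) k"
  shows "compactin (mtopology_of M) (\<Union>j\<in>J. A j) \<and> mdim_le M (\<Union>j\<in>J. A j) k"
  using assms
  by (induction J rule: finite_induct) (auto simp: mdim_le_empty intro: compactin_Un mdim_le_Un)

lemma mdim_le_sing: "mdim_le M {x} k"
  unfolding mdim_le_def covdim_le_def
proof (intro allI impI)
  fix \<U> assume U: "finite \<U> \<and> (\<forall>U\<in>\<U>. openin (subtopology (mtopology_of M) {x}) U) \<and>
    \<Union>\<U> = topspace (subtopology (mtopology_of M) {x})"
  let ?V = "\<U> \<inter> {{x}}"
  have "U = {} \<or> U = {x}" if "U \<in> \<U>" for U using that U openin_subset by fastforce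
  then have "\<Union>?V = \<Union>\<U>" by blast
  moreover have "card {V \<in> ?V. y \<in> V} \<le> k + 1" for y
  proof -
    have "card {V \<in> ?V. y \<in> V} \<le> card {{x}}" by (rule card_mono) auto
    then show ?thesis by simp
  qed
  ultimately show "\<exists>\<V>. finite \<V> \<and> (\<forall>V\<in>\<V>. openin (subtopology (mtopology_of M) {x}) V) \<and>
     \<Union>\<V> = topspace (subtopology (mtopology_of M) {x}) \<and> (\<forall>V\<in>\<V>. \<exists>U\<in>\<U>. V \<subseteq> U) \<and>
     (\<forall>y\<in>topspace (subtopology (mtopology_of M) {x}). card {V \<in> \<V>. y \<in> V} \<le> k + 1)"
    using U by (intro exI[of _ ?V]) auto
qed

section \<open>Continuous maps on subsets of a topological space\<close>

lemma compactin_image_top_of_set: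
  assumes "continuous_map (top_of_set C) Y f" "compact S" "S \<subseteq> C"
  shows "compactin Y (f ` S)"
  using image_compactin[OF _ assms(1)] assms by (simp add: compactin_subtopology)

lemma continuous_map_top_of_set_compose:
  assumes "continuous_map (top_of_set T) Y g" "continuous_on S \<phi>" "\<And>x. x \<in> S \<Longrightarrow> \<phi> x \<in> T"
  shows "continuous_map (top_of_set S) Y (\<lambda>x. g (\<phi> x))"
proof -
  have "continuous_map (top_of_set S) (top_of_set T) \<phi>"
    using assms by (auto simp: continuous_map_in_subtopology)
  from continuous_map_compose[OF this assms(1)] show ?thesis by (simp only: o_def)
qed

lemma continuous_map_glue_le:
  fixes p :: "'x::topological_space \<Rightarrow> real"
  assumes "continuous_on S p" "continuous_map (top_of_set {x\<in>S. p x \<le> c}) Y f"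
    "continuous_map (top_of_set {x\<in>S. c \<le> p x}) Y g"
    "\<And>x. \<lbrakk>x \<in> S; p x = c\<rbrakk> \<Longrightarrow> f x = g x"
  shows "continuous_map (top_of_set S) Y (\<lambda>x. if p x \<le> c then f x else g x)"
  by (rule continuous_map_cases_le)
     (use assms in \<open>auto simp: subtopology_subtopology Int_absorb1 Collect_conj_eq\<close>)

text \<open>Compactness of \<open>Sigma P R\<close> makes the family \<open>R\<close> upper
  semicontinuous: a thickened cover for the image of \<open>R p\<close> still works for all
  \<open>p'\<close> near \<open>p\<close>. Compactness of \<open>P\<close> then gives one distance
  \<open>d\<close> for all parameters, although the sets \<open>N\<close> vary.\<close>

lemma edim_le_uniform:
  fixes P :: "'p::t2_space set" and R :: "'p \<Rightarrow> 'x::topological_space set"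
  assumes f: "continuous_map (top_of_set C) (mtopology_of M) f"
    and P: "compact P" and K: "compact (Sigma P R)" and RC: "\<And>p. p \<in> P \<Longrightarrow> R p \<subseteq> C"
    and ed: "\<And>p. p \<in> P \<Longrightarrow> edim_le M e k (f ` R p)"
  obtains d where "d > 0"
    "\<And>p. p \<in> P \<Longrightarrow> \<exists>N. edim_le M e k N \<and> (\<forall>x\<in>R p. \<forall>y\<in>mspace M. mdist M (f x) y < d \<longrightarrow> y \<in> N)"
proof -
  interpret Metric_space "mspace M" "mdist M" by simp
  have fM: "f x \<in> mspace M" if "x \<in> C" for x
    using f that by (auto simp: continuous_map_def)
  have "\<exists>d G. d > 0 \<and> open G \<and> p \<in> G \<and>
      (\<forall>p'\<in>G \<inter> P. \<exists>N. edim_le M e k N \<and> (\<forall>x\<in>R p'. \<forall>y\<in>mspace M. mdist M (f x) y < d \<longrightarrow> y \<in> N))"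
    if p: "p \<in> P" for p
  proof -
    have "compact (Sigma P R \<inter> ({p} \<times> UNIV))"
      using K by (intro compact_Int_closed closed_Times) auto
    then have "compact (snd ` (Sigma P R \<inter> ({p} \<times> UNIV)))"
      by (intro compact_continuous_image continuous_intros)
    moreover have "snd ` (Sigma P R \<inter> ({p} \<times> UNIV)) = R p" using p by force
    ultimately have "compact (R p)" by simp
    then have cR: "compactin (mtopology_of M) (f ` R p)"
      using f RC[OF p] compactin_image_top_of_set by blast
    obtain \<W> where W: "finite \<W>" "f ` R p \<subseteq> \<Union>\<W>"
      "\<And>W. W \<in> \<W> \<Longrightarrow> openin (mtopology_of M) W \<and> (\<forall>x\<in>W. \<forall>y\<in>W. mdist M x y < e)"
      "\<And>x. card {W\<in>\<W>. x \<in> W} \<le> k + 1"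
      by (fact edim_le_thicken[OF cR ed[OF p]])
    have eN: "edim_le M e k (\<Union>\<W>)"
      unfolding edim_le_def using W(1,3,4) by (intro exI[of _ \<W>]) simp
    have "openin (mtopology_of M) (\<Union>\<W>)" using W(3) by blast
    then obtain d where d: "d > 0" "\<And>y. y \<in> f ` R p \<Longrightarrow> mball y d \<subseteq> \<Union>\<W>"
      using compactin_lebesgue_number[OF cR, of "{\<Union>\<W>}"] W(2) by (auto simp: mball_of_def)
    have "openin (top_of_set C) {x \<in> topspace (top_of_set C). f x \<in> (\<Union>y\<in>R p. mball (f y) (d/2))}"
      by (rule openin_continuous_map_preimage[OF f]) (auto simp: mtopology_of_def)
    then obtain T where T: "open T" "{x \<in> C. f x \<in> (\<Union>y\<in>R p. mball (f y) (d/2))} = C \<inter> T"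
      by (auto simp: openin_open)
    \<comment> \<open>As in the tube lemma, the parameters whose \<open>R p'\<close> leaves
      \<open>T\<close> form the projection of a compact set, hence a closed set; its complement is
      the required neighbourhood of \<open>p\<close>.\<close>
    have "compact (Sigma P R \<inter> (UNIV \<times> (- T)))"
      using K T(1) by (intro compact_Int_closed closed_Times) auto
    then have "compact (fst ` (Sigma P R \<inter> (UNIV \<times> (- T))))"
      by (intro compact_continuous_image continuous_intros)
    then have oG: "open (- (fst ` (Sigma P R \<inter> (UNIV \<times> (- T)))))"
      using compact_imp_closed by blast
    have "x \<in> T" if x: "x \<in> R p" for x
    proof -
      have "f x \<in> mball (f x) (d/2)" using fM RC[OF p] x d(1) by auto
      then show ?thesis using T(2) x RC[OF p] by blast
    qed
    then have pG: "p \<in> - (fst ` (Sigma P R \<inter> (UNIV \<times> (- T))))" by force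
    have G: "\<exists>N. edim_le M e k N \<and> (\<forall>x\<in>R p'. \<forall>y\<in>mspace M. mdist M (f x) y < d/2 \<longrightarrow> y \<in> N)"
      if p': "p' \<in> - (fst ` (Sigma P R \<inter> (UNIV \<times> (- T)))) \<inter> P" for p'
    proof (intro exI[of _ "\<Union>\<W>"] conjI ballI impI eN)
      fix x y assume x: "x \<in> R p'" and y: "y \<in> mspace M" "mdist M (f x) y < d/2"
      have "x \<in> T" using p' x by force
      then obtain z where z: "z \<in> R p" "f x \<in> mball (f z) (d/2)"
        using T(2) RC[of p'] p' x by blast
      have "mdist M (f z) y \<le> mdist M (f z) (f x) + mdist M (f x) y"
        using z y by (auto intro: triangle)
      then have "y \<in> mball (f z) d" using z y by auto
      then show "y \<in> \<Union>\<W>" using d(2) z(1) by blast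
    qed
    show ?thesis using d(1) oG pG G by (meson half_gt_zero)
  qed
  then obtain d G where dG: "\<And>p. p \<in> P \<Longrightarrow> d p > 0 \<and> open (G p) \<and> p \<in> G p \<and>
      (\<forall>p'\<in>G p \<inter> P. \<exists>N. edim_le M e k N \<and> (\<forall>x\<in>R p'. \<forall>y\<in>mspace M. mdist M (f x) y < d p \<longrightarrow> y \<in> N))"
    by metis
  obtain P' where P': "P' \<subseteq> P" "finite P'" "P \<subseteq> (\<Union>p\<in>P'. G p)"
    using compactE_image[OF P, of P G] dG by blast
  \<comment> \<open>The element \<open>1\<close> keeps the minimum meaningful when \<open>P'\<close>
    is empty.\<close>
  define \<delta> where "\<delta> = Min (insert 1 (d ` P'))"
  have "\<delta> > 0" unfolding \<delta>_def using P' dG by (subst Min_gr_iff) auto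
  moreover have "\<exists>N. edim_le M e k N \<and> (\<forall>x\<in>R p. \<forall>y\<in>mspace M. mdist M (f x) y < \<delta> \<longrightarrow> y \<in> N)"
    if p: "p \<in> P" for p
  proof -
    obtain q where q: "q \<in> P'" "p \<in> G q" using P' p by blast
    then have "\<delta> \<le> d q" unfolding \<delta>_def using P' by (intro Min_le) auto
    moreover obtain N where "edim_le M e k N" "\<And>x y. \<lbrakk>x\<in>R p; y\<in>mspace M; mdist M (f x) y < d q\<rbrakk> \<Longrightarrow> y \<in> N"
      using dG[of q] P' q p by blast
    ultimately show ?thesis by (meson order_less_le_trans)
  qed
  ultimately show thesis using that by blast
qed

text \<open>This is the openness needed for the Baire argument. The neighbourhoods \<open>N\<close>
  from \<open>edim_le_uniform\<close> absorb any uniformly small change of the map, for all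
  \<open>p\<close> at once.\<close>

lemma edim_le_stable:
  fixes P :: "'p::t2_space set" and R :: "'p \<Rightarrow> 'x::topological_space set"
  assumes f: "continuous_map (top_of_set C) (mtopology_of M) f"
    and P: "compact P" and K: "compact (Sigma P R)" and RC: "\<And>p. p \<in> P \<Longrightarrow> R p \<subseteq> C"
    and ed: "\<And>p. p \<in> P \<Longrightarrow> edim_le M e k (f ` R p)"
  shows "\<exists>d>0. \<forall>f'. continuous_map (top_of_set C) (mtopology_of M) f' \<longrightarrow>
           (\<forall>x\<in>C. mdist M (f x) (f' x) \<le> d) \<longrightarrow> (\<forall>p\<in>P. edim_le M e k (f' ` R p))"
proof -
  obtain d where d: "d > 0"
    "\<And>p. p \<in> P \<Longrightarrow> \<exists>N. edim_le M e k N \<and> (\<forall>x\<in>R p. \<forall>y\<in>mspace M. mdist M (f x) y < d \<longrightarrow> y \<in> N)"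
    by (rule edim_le_uniform[OF f P K RC ed]) (assumption, assumption, rule that)
  show ?thesis
  proof (intro exI[of _ "d/2"] conjI allI impI ballI)
    fix f' p
    assume f': "continuous_map (top_of_set C) (mtopology_of M) f'" "\<forall>x\<in>C. mdist M (f x) (f' x) \<le> d/2" and p: "p \<in> P"
    obtain N where N: "edim_le M e k N" "\<forall>x\<in>R p. \<forall>y\<in>mspace M. mdist M (f x) y < d \<longrightarrow> y \<in> N"
      using d(2)[OF p] by blast
    have "f' x \<in> N" if x: "x \<in> R p" for x
    proof -
      have xC: "x \<in> C" using RC[OF p] x by blast
      then have "mdist M (f x) (f' x) \<le> d/2" "f' x \<in> mspace M"
        using f' by (auto simp: continuous_map_def)
      then show ?thesis using N(2) x d(1) by force
    qed
    then show "edim_le M e k (f' ` R p)" by (intro edim_le_subset[OF N(1)]) blast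
  qed (use d in auto)
qed

section \<open>Small homotopies\<close>

text \<open>Non-strict pairwise bounds add up under concatenation and survive uniform limits; the
  strict diameter bound in \<open>FAP\<close> is recovered by halving \<open>e\<close>. Continuity
  of both ends is implied by that of \<open>h\<close>.\<close>

definition eps_homotopic ::
  "'a metric \<Rightarrow> 'x::topological_space set \<Rightarrow> real \<Rightarrow> ('x \<Rightarrow> 'a) \<Rightarrow> ('x \<Rightarrow> 'a) \<Rightarrow> bool" where
  "eps_homotopic M C e f g \<longleftrightarrow>
    (\<exists>h. continuous_map (top_of_set (C \<times> {0..1::real})) (mtopology_of M) h \<and>
         (\<forall>x\<in>C. h (x, 0) = f x \<and> h (x, 1) = g x) \<and>
         (\<forall>x\<in>C. \<forall>s\<in>{0..1}. \<forall>t\<in>{0..1}. mdist M (h (x, s)) (h (x, t)) \<le> e))"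

lemma eps_homotopicE:
  assumes "eps_homotopic M C e f g"
  obtains h where "continuous_map (top_of_set (C \<times> {0..1::real})) (mtopology_of M) h"
    "\<And>x. x \<in> C \<Longrightarrow> h (x, 0) = f x" "\<And>x. x \<in> C \<Longrightarrow> h (x, 1) = g x"
    "\<And>x s t. \<lbrakk>x \<in> C; s \<in> {0..1}; t \<in> {0..1}\<rbrakk> \<Longrightarrow> mdist M (h (x, s)) (h (x, t)) \<le> e"
  using assms unfolding eps_homotopic_def by blast

lemma eps_homotopic_continuous_map:
  assumes "eps_homotopic M C e f g"
  shows "continuous_map (top_of_set C) (mtopology_of M) f" "continuous_map (top_of_set C) (mtopology_of M) g"
proof -
  obtain h where h: "continuous_map (top_of_set (C \<times> {0..1::real})) (mtopology_of M) h"
    "\<And>x. x \<in> C \<Longrightarrow> h (x, 0) = f x" "\<And>x. x \<in> C \<Longrightarrow> h (x, 1) = g x"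
    using eps_homotopicE[OF assms] by metis
  have *: "continuous_map (top_of_set C) (mtopology_of M) (\<lambda>x. h (x, t))" if "t \<in> {0..1}" for t
    by (rule continuous_map_top_of_set_compose[OF h(1)]) (use that in \<open>auto intro!: continuous_intros\<close>)
  show "continuous_map (top_of_set C) (mtopology_of M) f" "continuous_map (top_of_set C) (mtopology_of M) g"
    using continuous_map_eq[OF *[of 0], of f] continuous_map_eq[OF *[of 1], of g] h by auto
qed

lemma eps_homotopic_dist:
  assumes "eps_homotopic M C e f g" "x \<in> C"
  shows "mdist M (f x) (g x) \<le> e"
  using eps_homotopicE[OF assms(1)] assms(2)
  by (metis atLeastAtMost_iff order_refl zero_le_one)

lemma eps_homotopic_mono:
  "eps_homotopic M C e f g \<Longrightarrow> e \<le> e' \<Longrightarrow> eps_homotopic M C e' f g"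
  unfolding eps_homotopic_def by (meson order_trans)

lemma eps_homotopic_refl:
  assumes "continuous_map (top_of_set C) (mtopology_of M) f" "0 \<le> e"
  shows "eps_homotopic M C e f f"
  unfolding eps_homotopic_def
proof (intro exI[of _ "\<lambda>(x,t). f x"] conjI)
  have "continuous_map (top_of_set (C \<times> {0..1::real})) (mtopology_of M) (\<lambda>z. f (fst z))"
    by (rule continuous_map_top_of_set_compose[OF assms(1)]) (auto intro!: continuous_intros)
  then show "continuous_map (top_of_set (C \<times> {0..1::real})) (mtopology_of M) (\<lambda>(x,t). f x)"
    by (simp add: case_prod_unfold)
  have "mdist M (f x) (f x) = 0" if "x \<in> C" for x
  proof -
    have "f x \<in> mspace M" using assms(1) that by (auto simp: continuous_map_def)
    then show ?thesis by simp
  qed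
  then show "\<forall>x\<in>C. \<forall>s\<in>{0..1}. \<forall>t\<in>{0..1}. mdist M ((\<lambda>(x,t). f x) (x, s)) ((\<lambda>(x,t). f x) (x, t)) \<le> e"
    using assms(2) by simp
qed auto

lemma eps_homotopic_trans:
  assumes "eps_homotopic M C a f g" "eps_homotopic M C b g k"
  shows "eps_homotopic M C (a + b) f k"
proof -
  obtain h where h: "continuous_map (top_of_set (C \<times> {0..1::real})) (mtopology_of M) h"
    "\<And>x. x \<in> C \<Longrightarrow> h (x, 0) = f x" "\<And>x. x \<in> C \<Longrightarrow> h (x, 1) = g x"
    "\<And>x s t. \<lbrakk>x \<in> C; s \<in> {0..1}; t \<in> {0..1}\<rbrakk> \<Longrightarrow> mdist M (h (x, s)) (h (x, t)) \<le> a"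
    by (fact eps_homotopicE[OF assms(1)])
  obtain h' where h': "continuous_map (top_of_set (C \<times> {0..1::real})) (mtopology_of M) h'"
    "\<And>x. x \<in> C \<Longrightarrow> h' (x, 0) = g x" "\<And>x. x \<in> C \<Longrightarrow> h' (x, 1) = k x"
    "\<And>x s t. \<lbrakk>x \<in> C; s \<in> {0..1}; t \<in> {0..1}\<rbrakk> \<Longrightarrow> mdist M (h' (x, s)) (h' (x, t)) \<le> b"
    by (fact eps_homotopicE[OF assms(2)])
  have hM: "h (x,t) \<in> mspace M" "h' (x,t) \<in> mspace M" if "x \<in> C" "t \<in> {0..1}" for x t
    using h(1) h'(1) that by (auto simp: continuous_map_def)
  define H where "H z = (if snd z \<le> 1/2 then h (fst z, 2 * snd z) else h' (fst z, 2 * snd z - 1))" for z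
  have "continuous_map (top_of_set (C \<times> {0..1::real})) (mtopology_of M) H"
    unfolding H_def
  proof (rule continuous_map_glue_le)
    show "continuous_map (top_of_set {x \<in> C \<times> {0..1}. snd x \<le> 1/2}) (mtopology_of M) (\<lambda>z. h (fst z, 2 * snd z))"
      by (rule continuous_map_top_of_set_compose[OF h(1)]) (auto intro!: continuous_intros)
    show "continuous_map (top_of_set {x \<in> C \<times> {0..1}. 1/2 \<le> snd x}) (mtopology_of M) (\<lambda>z. h' (fst z, 2 * snd z - 1))"
      by (rule continuous_map_top_of_set_compose[OF h'(1)]) (auto intro!: continuous_intros)
    show "h (fst z, 2 * snd z) = h' (fst z, 2 * snd z - 1)" if "z \<in> C \<times> {0..1}" "snd z = 1/2" for z
      using that h(3)[of "fst z"] h'(2)[of "fst z"] unfolding that(2) by auto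
  qed (auto intro!: continuous_intros)
  moreover have "H (x,0) = f x \<and> H (x,1) = k x" if "x \<in> C" for x
    using that h h' by (auto simp: H_def)
  moreover have "mdist M (H (x,s)) (H (x,t)) \<le> a + b"
    if x: "x \<in> C" and s: "s \<in> {0..1}" and t: "t \<in> {0..1}" for x s t
  proof -
    have nn: "a \<ge> 0" "b \<ge> 0"
      using order_trans[OF mdist_nonneg h(4)[OF x, of 0 0]] order_trans[OF mdist_nonneg h'(4)[OF x, of 0 0]] by auto
    have mix: "mdist M (H (x,s)) (H (x,t)) \<le> a + b" if s: "s \<in> {0..1}" "s \<le> 1/2" and t: "t \<in> {0..1}" "t > 1/2" for s t
    proof -
      have "mdist M (h (x,2 * s)) (h' (x,2*t-1)) \<le> mdist M (h (x,2 * s)) (g x) + mdist M (g x) (h' (x,2*t-1))"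
        using hM[OF x] s t h(3)[OF x] by (intro mdist_triangle) (auto, metis hM(1)[OF x, of 1] atLeastAtMost_iff order_refl zero_le_one)
      moreover have "mdist M (h (x,2 * s)) (g x) \<le> a" using h(4)[OF x, of "2 * s" 1] h(3)[OF x] s by auto
      moreover have "mdist M (g x) (h' (x,2*t-1)) \<le> b" using h'(4)[OF x, of 0 "2*t-1"] h'(2)[OF x] t by auto
      ultimately show ?thesis using s t by (simp add: H_def)
    qed
    consider "s \<le> 1/2" "t \<le> 1/2" | "s > 1/2" "t > 1/2" | "s \<le> 1/2" "t > 1/2" | "s > 1/2" "t \<le> 1/2"
      by linarith
    then show ?thesis
    proof cases
      case 1
      then show ?thesis using h(4)[OF x, of "2 * s" "2*t"] s t nn by (simp add: H_def)
    next
      case 2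
      then show ?thesis using h'(4)[OF x, of "2 * s-1" "2*t-1"] s t nn by (simp add: H_def)
    next
      case 3
      then show ?thesis using mix s t by blast
    next
      case 4
      then show ?thesis using mix[of t s] s t by (simp add: mdist_commute)
    qed
  qed
  ultimately show ?thesis unfolding eps_homotopic_def by blast
qed

section \<open>Change of coordinates, infinite concatenation and Baire's argument\<close>

lemma eps_homotopic_compose:
  assumes "eps_homotopic M C' e g g'" "continuous_on C \<phi>" "\<And>x. x \<in> C \<Longrightarrow> \<phi> x \<in> C'"
    and "\<And>x. x \<in> C \<Longrightarrow> g (\<phi> x) = f x"
  shows "eps_homotopic M C e f (\<lambda>x. g' (\<phi> x))"
proof -
  obtain h where h: "continuous_map (top_of_set (C' \<times> {0..1::real})) (mtopology_of M) h"
    "\<And>x. x \<in> C' \<Longrightarrow> h (x, 0) = g x" "\<And>x. x \<in> C' \<Longrightarrow> h (x, 1) = g' x"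
    "\<And>x s t. \<lbrakk>x \<in> C'; s \<in> {0..1}; t \<in> {0..1}\<rbrakk> \<Longrightarrow> mdist M (h (x, s)) (h (x, t)) \<le> e"
    by (fact eps_homotopicE[OF assms(1)])
  show ?thesis
    unfolding eps_homotopic_def
  proof (intro exI[of _ "\<lambda>z. h (\<phi> (fst z), snd z)"] conjI)
    show "continuous_map (top_of_set (C \<times> {0..1})) (mtopology_of M) (\<lambda>z. h (\<phi> (fst z), snd z))"
      by (rule continuous_map_top_of_set_compose[OF h(1)])
         (use assms(3) in \<open>auto intro!: continuous_intros continuous_on_compose2[OF assms(2)]\<close>)
  qed (use h assms in auto)
qed

text \<open>The homotopies are run one after another on time intervals accumulating at
  \<open>1\<close>. Geometric decay makes the partial concatenations uniformly Cauchy, so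
  completeness gives a continuous limit; the sum of all \<open>e i\<close> is at most
  \<open>2 * e 0\<close>.\<close>

lemma eps_homotopic_limit:
  fixes f :: "nat \<Rightarrow> 'x::topological_space \<Rightarrow> 'a"
  assumes M: "mcomplete_of M" and f: "\<And>i. eps_homotopic M C (e i) (f i) (f (Suc i))"
    and e0: "\<And>i. e i > 0" and e: "\<And>i. e (Suc i) \<le> e i / 2"
  obtains g where "eps_homotopic M C (2 * e 0) (f 0) g" "\<And>i x. x \<in> C \<Longrightarrow> mdist M (f i x) (g x) \<le> 2 * e i"
proof -
  interpret Metric_space "mspace M" "mdist M" by simp
  let ?D = "C \<times> {0..1::real}"
  have "\<forall>i. \<exists>h. continuous_map (top_of_set ?D) (mtopology_of M) h \<and>
         (\<forall>x\<in>C. h (x, 0) = f i x \<and> h (x, 1) = f (Suc i) x) \<and>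
         (\<forall>x\<in>C. \<forall>s\<in>{0..1}. \<forall>t\<in>{0..1}. mdist M (h (x, s)) (h (x, t)) \<le> e i)"
    using f unfolding eps_homotopic_def by blast
  then obtain h where h: "\<And>i. continuous_map (top_of_set ?D) (mtopology_of M) (h i)"
    "\<And>i x. x \<in> C \<Longrightarrow> h i (x, 0) = f i x" "\<And>i x. x \<in> C \<Longrightarrow> h i (x, 1) = f (Suc i) x"
    "\<And>i x s t. \<lbrakk>x \<in> C; s \<in> {0..1}; t \<in> {0..1}\<rbrakk> \<Longrightarrow> mdist M (h i (x, s)) (h i (x, t)) \<le> e i"
    by metis
  \<comment> \<open>The \<open>i\<close>-th homotopy occupies the time from \<open>a i\<close> to
    \<open>a (Suc i)\<close>, of length \<open>1 / 2 ^ Suc i\<close>; \<open>q i\<close> below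
    rescales this interval to the unit interval and stays at \<open>1\<close> afterwards.\<close>
  define a where "a i = 1 - (1/2::real) ^ i" for i :: nat
  have a01: "0 \<le> a i" "a i \<le> 1" for i
    unfolding a_def by (auto simp: power_le_one)
  have aSuc: "(a (Suc i) - a i) * 2 ^ Suc i = 1" for i
    unfolding a_def by (simp add: field_simps power_divide)
  define q where "q i t = min 1 ((t - a i) * 2 ^ Suc i)" for i t
  have q01: "q i t \<in> {0..1}" if "a i \<le> t" for i t
    unfolding q_def using that by auto
  define H where "H = rec_nat (\<lambda>z. f 0 (fst z))
     (\<lambda>i G z. if snd z \<le> a i then G z else h i (fst z, q i (snd z)))"
  have H0: "H 0 z = f 0 (fst z)" for z by (simp add: H_def)
  have HS: "H (Suc i) z = (if snd z \<le> a i then H i z else h i (fst z, q i (snd z)))" for i z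
    by (simp add: H_def)
  have late: "H i (x,t) = f i x" if "x \<in> C" "t \<in> {0..1}" "a i \<le> t" for i x t
    using that
  proof (induction i arbitrary: t)
    case 0
    then show ?case by (simp add: H0)
  next
    case (Suc i)
    have "(a (Suc i) - a i) * 2 ^ Suc i \<le> (t - a i) * 2 ^ Suc i"
      using Suc.prems by (intro mult_right_mono) auto
    then have "q i t = 1" unfolding q_def aSuc by simp
    moreover have "a i < a (Suc i)" unfolding a_def by simp
    ultimately show ?case using Suc.prems h(3) by (simp add: HS)
  qed
  have contH: "continuous_map (top_of_set ?D) (mtopology_of M) (H i)" for i
  proof (induction i)
    case 0
    have "continuous_map (top_of_set ?D) (mtopology_of M) (\<lambda>z. f 0 (fst z))"
      by (rule continuous_map_top_of_set_compose[OF eps_homotopic_continuous_map(1)[OF f[of 0]]])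
         (auto intro!: continuous_intros)
    then show ?case unfolding H0[abs_def] .
  next
    case (Suc i)
    have "continuous_map (top_of_set ?D) (mtopology_of M)
        (\<lambda>z. if snd z \<le> a i then H i z else h i (fst z, q i (snd z)))"
    proof (rule continuous_map_glue_le)
      show "continuous_map (top_of_set {x \<in> ?D. snd x \<le> a i}) (mtopology_of M) (H i)"
        using continuous_map_from_subtopology[OF Suc, of "{x \<in> ?D. snd x \<le> a i}"]
        by (simp add: subtopology_subtopology Int_absorb1 Collect_conj_eq)
      show "continuous_map (top_of_set {x \<in> ?D. a i \<le> snd x}) (mtopology_of M) (\<lambda>z. h i (fst z, q i (snd z)))"
        by (rule continuous_map_top_of_set_compose[OF h(1)])
           (use q01 in \<open>auto simp: q_def intro!: continuous_intros\<close>)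
      show "H i z = h i (fst z, q i (snd z))" if "z \<in> ?D" "snd z = a i" for z
        using that late[of "fst z" "snd z" i] h(2)[of "fst z" i] by (auto simp: q_def)
    qed (auto intro!: continuous_intros)
    then show ?case unfolding HS[abs_def] .
  qed
  have HM: "H i (x,t) \<in> mspace M" if "x \<in> C" "t \<in> {0..1}" for i x t
    using contH[of i] that by (auto simp: continuous_map_def)
  have hM: "h i (x,t) \<in> mspace M" if "x \<in> C" "t \<in> {0..1}" for i x t
    using h(1)[of i] that by (auto simp: continuous_map_def)
  have edec: "e i \<le> e 0" for i
  proof (induction i)
    case (Suc i)
    then show ?case using e[of i] e0[of i] by linarith
  qed simp
  have near: "mdist M (f i x) (h i (x, t)) \<le> e i" if "x \<in> C" "t \<in> {0..1}" for i x t
    using h(4)[of x 0 t i] h(2) that by auto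
  have step: "mdist M (H i (x,t)) (H (Suc i) (x,t)) \<le> e i" if x: "x \<in> C" "t \<in> {0..1}" for i x t
  proof (cases "t \<le> a i")
    case True
    then show ?thesis using HM[OF x] e0[of i] by (simp add: HS)
  next
    case False
    then show ?thesis using late[OF x, of i] near[of x "q i t" i] q01[of i t] x by (simp add: HS)
  qed
  \<comment> \<open>The bound telescopes: \<open>e i \<le> 2 * e i - 2 * e (Suc i)\<close>, because
    each bound is at most half of the previous one.\<close>
  have Cau: "mdist M (H i (x,t)) (H j (x,t)) \<le> 2 * e i - 2 * e j" if x: "x \<in> C" "t \<in> {0..1}" and ij: "i \<le> j" for i j x t
    using ij
  proof (induction rule: dec_induct)
    case base
    then show ?case using HM[OF x] by simp
  next
    case (step n)
    have "mdist M (H i (x,t)) (H (Suc n) (x,t)) \<le> mdist M (H i (x,t)) (H n (x,t)) + mdist M (H n (x,t)) (H (Suc n) (x,t))"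
      using HM[OF x] by (intro mdist_triangle)
    then show ?case using step.IH \<open>\<And>x t i. \<lbrakk>x \<in> C; t \<in> {0..1}\<rbrakk> \<Longrightarrow> mdist M (H i (x,t)) (H (Suc i) (x,t)) \<le> e i\<close>[OF x, of n] e[of n]
      by linarith
  qed
  \<comment> \<open>The same telescoping quantity bounds the tracks. If only \<open>t\<close> lies
    beyond \<open>a i\<close>, the triangle inequality goes through
    \<open>H i (x,t) = f i x\<close>, and the new homotopy contributes at most
    \<open>e i\<close>.\<close>
  have diam: "mdist M (H i (x,s)) (H i (x,t)) \<le> 2 * e 0 - 2 * e i" if x: "x \<in> C" and "s \<in> {0..1}" "t \<in> {0..1}" for i x s t
    using that(2,3)
  proof (induction i arbitrary: s t)
    case 0
    then show ?case using HM[OF x, of s 0] by (simp add: H0)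
  next
    case (Suc i)
    have mix: "mdist M (H (Suc i) (x,s)) (H (Suc i) (x,t)) \<le> 2 * e 0 - e i"
      if s: "s \<in> {0..1}" "s \<le> a i" and t: "t \<in> {0..1}" "t > a i" for s t
    proof -
      have q: "q i t \<in> {0..1}" using q01 t by simp
      have "mdist M (H i (x,s)) (h i (x,q i t)) \<le> mdist M (H i (x,s)) (H i (x,t)) + mdist M (H i (x,t)) (h i (x,q i t))"
        using HM[OF x] hM[OF x] s t q by (intro mdist_triangle) auto
      moreover have "mdist M (H i (x,t)) (h i (x,q i t)) \<le> e i"
        using late[OF x t(1), of i] t near[OF x q] by simp
      ultimately show ?thesis using Suc.IH[OF s(1) t(1)] s t by (simp add: HS)
    qed
    consider "s \<le> a i" "t \<le> a i" | "s > a i" "t > a i" | "s \<le> a i" "t > a i" | "s > a i" "t \<le> a i"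
      by linarith
    then have "mdist M (H (Suc i) (x,s)) (H (Suc i) (x,t)) \<le> 2 * e 0 - e i"
    proof cases
      case 1
      then show ?thesis using Suc.IH[OF Suc.prems] e0[of i] by (simp add: HS)
    next
      case 2
      then show ?thesis using h(4)[OF x q01[of i s] q01[of i t], of i] edec[of i] by (simp add: HS)
    next
      case 3
      then show ?thesis using mix Suc.prems by blast
    next
      case 4
      then show ?thesis using mix[of t s] Suc.prems by (simp add: mdist_commute)
    qed
    then show ?case using e[of i] by linarith
  qed
  have epow: "e i \<le> e 0 * (1/2) ^ i" for i
  proof (induction i)
    case (Suc i)
    then show ?case using e[of i] by simp
  qed simp
  have "(\<lambda>i. e 0 * (1/2) ^ i) \<longlonglongrightarrow> 0"
    by (intro tendsto_mult_right_zero LIMSEQ_power_zero) simp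
  then have elim: "e \<longlonglongrightarrow> 0"
    by (rule tendsto_sandwich[rotated 3]) (use e0 epow in \<open>auto intro!: always_eventually less_imp_le\<close>)
  have esmall: "\<exists>N. \<forall>n\<ge>N. e n < r" if "r > 0" for r
    using LIMSEQ_D[OF elim that] e0 by (metis abs_of_pos diff_zero real_norm_def)
  have mc: "mcomplete" using M by (simp add: mcomplete_of_def)
  have contH': "\<forall>\<^sub>F n in sequentially. continuous_map (top_of_set ?D) mtopology (H n)"
    using contH by (simp add: mtopology_of_def)
  have CC: "\<exists>N. \<forall>m n z. N \<le> m \<longrightarrow> N \<le> n \<longrightarrow> z \<in> topspace (top_of_set ?D) \<longrightarrow> mdist M (H m z) (H n z) < r" if "r > 0" for r
  proof -
    obtain N where N: "\<And>n. n \<ge> N \<Longrightarrow> e n < r/2" using esmall[of "r/2"] \<open>r > 0\<close> by auto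
    have "mdist M (H m (x,t)) (H n (x,t)) < r" if "N \<le> m" "N \<le> n" "x \<in> C" "t \<in> {0..1}" for m n x t
    proof (cases "m \<le> n")
      case True
      then show ?thesis using Cau[OF that(3,4) True] N[OF that(1)] e0[of n] by linarith
    next
      case False
      then show ?thesis using Cau[OF that(3,4), of n m] N[OF that(2)] e0[of m] by (simp add: mdist_commute)
    qed
    then show ?thesis by (intro exI[of _ N]) auto
  qed
  obtain G where G: "continuous_map (top_of_set ?D) mtopology G"
    "\<And>r. 0 < r \<Longrightarrow> \<forall>\<^sub>F n in sequentially. \<forall>z\<in>topspace (top_of_set ?D). mdist M (H n z) (G z) < r"
    by (rule continuous_map_uniformly_Cauchy_limit[OF mc contH' CC]) (assumption, rule that)
  have GM: "G (x,t) \<in> mspace M" if "x \<in> C" "t \<in> {0..1}" for x t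
    using G(1) that by (auto simp: continuous_map_def)
  have HG: "mdist M (H i (x,t)) (G (x,t)) \<le> 2 * e i" if x: "x \<in> C" "t \<in> {0..1}" for i x t
  proof (rule field_le_epsilon)
    fix r :: real assume "r > 0"
    from G(2)[OF this] obtain N where N: "\<And>n. n \<ge> N \<Longrightarrow> mdist M (H n (x,t)) (G (x,t)) < r"
      using x by (force simp: eventually_sequentially)
    let ?n = "max N i"
    have "mdist M (H i (x,t)) (G (x,t)) \<le> mdist M (H i (x,t)) (H ?n (x,t)) + mdist M (H ?n (x,t)) (G (x,t))"
      using HM[OF x] GM[OF x] by (intro mdist_triangle)
    then show "mdist M (H i (x,t)) (G (x,t)) \<le> 2 * e i + r"
      using N[of ?n] Cau[OF x, of i ?n] e0[of ?n] by simp
  qed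
  have Gd: "mdist M (G (x,s)) (G (x,t)) \<le> 2 * e 0" if x: "x \<in> C" and s: "s \<in> {0..1}" and t: "t \<in> {0..1}" for x s t
  proof (rule field_le_epsilon)
    fix r :: real assume "r > 0"
    then obtain n where n: "e n < r/2" using esmall[of "r/2"] by auto
    have "mdist M (G (x,s)) (G (x,t)) \<le> mdist M (G (x,s)) (H n (x,s)) + mdist M (H n (x,s)) (G (x,t))"
      using HM[OF x] GM[OF x] s t by (intro mdist_triangle)
    moreover have "mdist M (H n (x,s)) (G (x,t)) \<le> mdist M (H n (x,s)) (H n (x,t)) + mdist M (H n (x,t)) (G (x,t))"
      using HM[OF x] GM[OF x] s t by (intro mdist_triangle)
    moreover have "mdist M (G (x,s)) (H n (x,s)) \<le> 2 * e n" using HG[OF x s, of n] by (simp add: mdist_commute)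
    ultimately show "mdist M (G (x,s)) (G (x,t)) \<le> 2 * e 0 + r"
      using HG[OF x t, of n] diam[OF x s t, of n] n by linarith
  qed
  have H00: "H i (x,0) = f 0 x" for i x
    by (induction i) (auto simp: H0 HS a01)
  \<comment> \<open>Every \<open>H n\<close> starts at \<open>f 0\<close>, so this distance is at
    most \<open>2 * e n\<close> for all \<open>n\<close> and hence zero.\<close>
  have G0: "G (x,0) = f 0 x" if x: "x \<in> C" for x
  proof -
    have "mdist M (f 0 x) (G (x,0)) \<le> 0 + r" if "r > 0" for r
    proof -
      obtain n where n: "e n < r/2" using esmall[of "r/2"] \<open>r > 0\<close> by auto
      then show ?thesis using HG[OF x, of 0 n] H00[of n x] by simp
    qed
    then have "mdist M (f 0 x) (G (x,0)) \<le> 0" by (rule field_le_epsilon)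
    then have "mdist M (f 0 x) (G (x,0)) = 0" by (intro order_antisym mdist_nonneg)
    moreover have "f 0 x \<in> mspace M" using HM[OF x, of 0 0] by (simp add: H0)
    ultimately show ?thesis using GM[OF x, of 0] mdist_zero by fastforce
  qed
  show thesis
  proof (rule that[of "\<lambda>x. G (x,1)"])
    show "eps_homotopic M C (2 * e 0) (f 0) (\<lambda>x. G (x,1))"
      unfolding eps_homotopic_def using G(1) G0 Gd by (intro exI[of _ G]) (auto simp: mtopology_of_def)
    show "mdist M (f i x) (G (x,1)) \<le> 2 * e i" if "x \<in> C" for i x
      using HG[OF that, of 1 i] late[OF that, of 1 i] a01 by simp
  qed
qed

text \<open>As soon as \<open>Q i\<close> is achieved it holds for all maps within some
  \<open>d\<close>, and the bounds for the remaining stages are chosen so small that the limit stays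
  within \<open>d\<close>. Hence the limit inherits every \<open>Q i\<close>.\<close>

lemma eps_homotopic_Baire:
  fixes C :: "'x::topological_space set" and Q :: "nat \<Rightarrow> ('x \<Rightarrow> 'a) \<Rightarrow> bool"
  assumes M: "mcomplete_of M"
    and stable: "\<And>j f. \<lbrakk>continuous_map (top_of_set C) (mtopology_of M) f; Q j f\<rbrakk> \<Longrightarrow>
       \<exists>d>0. \<forall>f'. continuous_map (top_of_set C) (mtopology_of M) f' \<longrightarrow>
               (\<forall>x\<in>C. mdist M (f x) (f' x) \<le> d) \<longrightarrow> Q j f'"
    and dense: "\<And>j f e. \<lbrakk>continuous_map (top_of_set C) (mtopology_of M) f; e > 0\<rbrakk> \<Longrightarrow>
       \<exists>f'. eps_homotopic M C e f f' \<and> Q j f'"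
    and f0: "continuous_map (top_of_set C) (mtopology_of M) f0" and r: "r > 0"
  obtains f where "eps_homotopic M C r f0 f" "\<And>j. Q j f"
proof -
  let ?c = "\<lambda>f. continuous_map (top_of_set C) (mtopology_of M) f"
  \<comment> \<open>\<open>F i\<close> pairs a map with the bound for the next homotopy. The first
    bound is \<open>r/2\<close> because the limit may move by twice that bound.\<close>
  have "\<exists>F. \<forall>i. (?c (fst (F i)) \<and> snd (F i) > 0 \<and> (i = 0 \<longrightarrow> F i = (f0, r/2))) \<and>
     (eps_homotopic M C (snd (F i)) (fst (F i)) (fst (F (Suc i))) \<and> snd (F (Suc i)) \<le> snd (F i) / 2 \<and>
      (\<forall>f'. ?c f' \<longrightarrow> (\<forall>x\<in>C. mdist M (fst (F (Suc i)) x) (f' x) \<le> 2 * snd (F (Suc i))) \<longrightarrow> Q i f'))"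
  proof (rule dependent_nat_choice)
    show "\<exists>p. ?c (fst p) \<and> snd p > 0 \<and> (0 = (0::nat) \<longrightarrow> p = (f0, r/2))"
      using f0 r by (intro exI[of _ "(f0, r/2)"]) simp
  next
    fix p :: "('x \<Rightarrow> 'a) \<times> real" and i :: nat
    assume p: "?c (fst p) \<and> snd p > 0 \<and> (i = 0 \<longrightarrow> p = (f0, r/2))"
    then obtain f' where f': "eps_homotopic M C (snd p) (fst p) f'" "Q i f'" using dense by blast
    have c': "?c f'" using eps_homotopic_continuous_map(2)[OF f'(1)] .
    obtain d where d: "d > 0" "\<And>f''. \<lbrakk>?c f''; \<forall>x\<in>C. mdist M (f' x) (f'' x) \<le> d\<rbrakk> \<Longrightarrow> Q i f''"
      using stable[OF c' f'(2)] by blast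
    \<comment> \<open>\<open>d/2\<close> allows for the doubled bound of the limit; half of the
      previous bound makes the bounds decay geometrically.\<close>
    define d' where "d' = min (d/2) (snd p / 2)"
    have d': "d' > 0" "2 * d' \<le> d" "d' \<le> snd p / 2" using d(1) p by (auto simp: d'_def)
    show "\<exists>q. (?c (fst q) \<and> snd q > 0 \<and> (Suc i = 0 \<longrightarrow> q = (f0, r/2))) \<and>
     (eps_homotopic M C (snd p) (fst p) (fst q) \<and> snd q \<le> snd p / 2 \<and>
      (\<forall>f'. ?c f' \<longrightarrow> (\<forall>x\<in>C. mdist M (fst q x) (f' x) \<le> 2 * snd q) \<longrightarrow> Q i f'))"
    proof (intro exI[of _ "(f', d')"] conjI allI impI)
      fix f'' assume "?c f''" "\<forall>x\<in>C. mdist M (fst (f', d') x) (f'' x) \<le> 2 * snd (f', d')"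
      then show "Q i f''" using d' by (intro d(2)) force+
    qed (use c' d' f' in auto)
  qed
  then obtain F where F0: "\<forall>i. (?c (fst (F i)) \<and> snd (F i) > 0 \<and> (i = 0 \<longrightarrow> F i = (f0, r/2))) \<and>
     (eps_homotopic M C (snd (F i)) (fst (F i)) (fst (F (Suc i))) \<and> snd (F (Suc i)) \<le> snd (F i) / 2 \<and>
      (\<forall>f'. ?c f' \<longrightarrow> (\<forall>x\<in>C. mdist M (fst (F (Suc i)) x) (f' x) \<le> 2 * snd (F (Suc i))) \<longrightarrow> Q i f'))"
    by (elim exE)
  have F: "\<And>i. ?c (fst (F i))" "\<And>i. snd (F i) > 0" "F 0 = (f0, r/2)"
     "\<And>i. eps_homotopic M C (snd (F i)) (fst (F i)) (fst (F (Suc i)))" "\<And>i. snd (F (Suc i)) \<le> snd (F i) / 2"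
     "\<And>i f'. \<lbrakk>?c f'; \<forall>x\<in>C. mdist M (fst (F (Suc i)) x) (f' x) \<le> 2 * snd (F (Suc i))\<rbrakk> \<Longrightarrow> Q i f'"
    using F0 by simp_all
  obtain g where g: "eps_homotopic M C (2 * snd (F 0)) (fst (F 0)) g"
      "\<And>i x. x \<in> C \<Longrightarrow> mdist M (fst (F i) x) (g x) \<le> 2 * snd (F i)"
    using eps_homotopic_limit[OF M, of C "\<lambda>i. snd (F i)" "\<lambda>i. fst (F i)"] F(2,4,5) by blast
  show thesis
  proof (rule that)
    show "eps_homotopic M C r f0 g" using g(1) F(3) by simp
    show "Q j g" for j
      using F(6)[of g j] g(2) eps_homotopic_continuous_map(2)[OF g(1)] by blast
  qed
qed

section \<open>Cubes and slices\<close>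

definition cube :: "nat \<Rightarrow> (nat \<Rightarrow> real) set" where
  "cube m = {x. (\<forall>i<m. 0 \<le> x i \<and> x i \<le> 1) \<and> (\<forall>i\<ge>m. x i = 0)}"

lemma Icube_eq: "Icube m = top_of_set (cube m)"
proof -
  have "{x. \<forall>i\<ge>m. x i = 0} \<inter> {x. \<forall>i<m. 0 \<le> x i \<and> x i \<le> 1} = cube m"
    by (auto simp: cube_def)
  then show ?thesis
    by (simp add: Icube_def Euclidean_space_def euclidean_product_topology subtopology_subtopology)
qed

lemma compact_cube: "compact (cube m)"
proof -
  have "cube m = Pi\<^sub>E UNIV (\<lambda>i. if i < m then {0..1} else {0})"
    unfolding cube_def by (fastforce simp: PiE_iff split: if_splits)
  moreover have "compactin (product_topology (\<lambda>i. euclidean) UNIV) (Pi\<^sub>E UNIV (\<lambda>i. if i < m then {0..1} else {0::real}))"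
    by (simp add: compactin_PiE)
  ultimately show ?thesis by (simp add: euclidean_product_topology)
qed

section \<open>Diameters, and FAP in terms of small homotopies\<close>

lemma mdist_less_if_mdiam_less:
  assumes "compactin (mtopology_of M) S" "mdiam M S < e" "x \<in> S" "y \<in> S"
  shows "mdist M x y < e"
proof -
  interpret Metric_space "mspace M" "mdist M" by simp
  \<comment> \<open>Compactness supplies the boundedness without which the supremum in
    \<open>mdiam\<close> says nothing.\<close>
  have "mbounded S" using assms(1) compactin_imp_mbounded by (simp add: mtopology_of_def)
  then obtain B where "\<And>x y. \<lbrakk>x \<in> S; y \<in> S\<rbrakk> \<Longrightarrow> mdist M x y \<le> B" by (auto simp: mbounded_alt)
  then have "bdd_above {mdist M x y | x y. x \<in> S \<and> y \<in> S}" by (auto simp: bdd_above_def)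
  then have "mdist M x y \<le> mdiam M S" unfolding mdiam_def using assms(3,4) by (intro cSup_upper) auto
  then show ?thesis using assms(2) by simp
qed

lemma mdiam_le:
  assumes "S \<noteq> {}" "\<And>x y. \<lbrakk>x \<in> S; y \<in> S\<rbrakk> \<Longrightarrow> mdist M x y \<le> e"
  shows "mdiam M S \<le> e"
  unfolding mdiam_def
proof (rule cSup_least)
  show "{mdist M x y |x y. x \<in> S \<and> y \<in> S} \<noteq> {}" using assms(1) by blast
qed (use assms(2) in auto)

lemma FAP_D:
  assumes F: "FAP k M" and e: "e > 0" and g: "continuous_map (top_of_set (cube m \<times> cube k)) (mtopology_of M) g"
  obtains g' where "eps_homotopic M (cube m \<times> cube k) e g g'"
    "\<And>z. z \<in> cube m \<Longrightarrow> mdim_le M (g' ` ({z} \<times> cube k)) k"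
proof -
  have pt: "prod_topology (top_of_set A) (top_of_set B) = top_of_set (A \<times> B)"
    for A :: "'c::topological_space set" and B :: "'d::topological_space set" by simp
  have "\<exists>g' h. continuous_map (top_of_set (cube m \<times> cube k)) (mtopology_of M) g' \<and>
     continuous_map (top_of_set ((cube m \<times> cube k) \<times> {0..1::real})) (mtopology_of M) h \<and>
     (\<forall>x\<in>cube m \<times> cube k. h (x, 0) = g x \<and> h (x, 1) = g' x \<and> mdiam M (h ` ({x} \<times> {0..1::real})) < e) \<and>
     (\<forall>z\<in>cube m. mdim_le M (g' ` ({z} \<times> cube k)) k)"
    using F[unfolded FAP_def Icube_eq pt topspace_euclidean_subtopology] e g by blast
  then obtain g' h where h: "continuous_map (top_of_set ((cube m \<times> cube k) \<times> {0..1::real})) (mtopology_of M) h \<and>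
     (\<forall>x\<in>cube m \<times> cube k. h (x, 0) = g x \<and> h (x, 1) = g' x \<and> mdiam M (h ` ({x} \<times> {0..1::real})) < e) \<and>
     (\<forall>z\<in>cube m. mdim_le M (g' ` ({z} \<times> cube k)) k)"
    by (elim exE conjE) (rule that, intro conjI)
  have "mdist M (h (x,s)) (h (x,t)) \<le> e" if "x \<in> cube m \<times> cube k" "s \<in> {0..1}" "t \<in> {0..1}" for x s t
  proof (rule less_imp_le, rule mdist_less_if_mdiam_less)
    show "compactin (mtopology_of M) (h ` ({x} \<times> {0..1::real}))"
      by (rule compactin_image_top_of_set[OF conjunct1[OF h]]) (use that in \<open>auto intro!: compact_Times\<close>)
  qed (use h that in auto)
  then have "eps_homotopic M (cube m \<times> cube k) e g g'"
    unfolding eps_homotopic_def using h by blast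
  then show thesis using that h by blast
qed

lemma FAP_I:
  assumes "\<And>e m g. \<lbrakk>e > 0; continuous_map (top_of_set (cube m \<times> cube k)) (mtopology_of M) g\<rbrakk> \<Longrightarrow>
    \<exists>g'. eps_homotopic M (cube m \<times> cube k) e g g' \<and> (\<forall>z\<in>cube m. mdim_le M (g' ` ({z} \<times> cube k)) k)"
  shows "FAP k M"
  unfolding FAP_def Icube_eq
proof (intro allI impI)
  fix e :: real and m g
  assume e: "e > 0" and "continuous_map (prod_topology (top_of_set (cube m)) (top_of_set (cube k))) (mtopology_of M) g"
  then have g: "continuous_map (top_of_set (cube m \<times> cube k)) (mtopology_of M) g" by simp
  \<comment> \<open>Taken at \<open>e/2\<close>, so that the non-strict bound yields diameters
    strictly below \<open>e\<close>.\<close>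
  obtain g' where g': "eps_homotopic M (cube m \<times> cube k) (e/2) g g'" "\<forall>z\<in>cube m. mdim_le M (g' ` ({z} \<times> cube k)) k"
    using assms[OF _ g, of "e/2"] e by auto
  obtain h where h: "continuous_map (top_of_set ((cube m \<times> cube k) \<times> {0..1::real})) (mtopology_of M) h"
    "\<And>x. x \<in> cube m \<times> cube k \<Longrightarrow> h (x, 0) = g x" "\<And>x. x \<in> cube m \<times> cube k \<Longrightarrow> h (x, 1) = g' x"
    "\<And>x s t. \<lbrakk>x \<in> cube m \<times> cube k; s \<in> {0..1}; t \<in> {0..1}\<rbrakk> \<Longrightarrow> mdist M (h (x, s)) (h (x, t)) \<le> e/2"
    by (fact eps_homotopicE[OF g'(1)])
  have "mdiam M (h ` ({x} \<times> {0..1})) < e" if "x \<in> cube m \<times> cube k" for x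
  proof -
    have "mdiam M (h ` ({x} \<times> {0..1})) \<le> e/2" by (rule mdiam_le) (use h(4) that in auto)
    then show ?thesis using e by simp
  qed
  then show "\<exists>g' h. continuous_map (prod_topology (top_of_set (cube m)) (top_of_set (cube k))) (mtopology_of M) g' \<and>
          continuous_map (prod_topology (prod_topology (top_of_set (cube m)) (top_of_set (cube k))) (top_of_set {0..1::real}))
                         (mtopology_of M) h \<and>
          (\<forall>x\<in>topspace (prod_topology (top_of_set (cube m)) (top_of_set (cube k))).
              h (x, 0) = g x \<and> h (x, 1) = g' x \<and> mdiam M (h ` ({x} \<times> {0..1::real})) < e) \<and>
          (\<forall>z\<in>topspace (top_of_set (cube m)). mdim_le M (g' ` ({z} \<times> topspace (top_of_set (cube k)))) k)"
    using eps_homotopic_continuous_map(2)[OF g'(1)] g'(2) h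
    by (intro exI[of _ g'] exI[of _ h]) auto
qed

section \<open>Slices of codimension one\<close>

lemma continuous_on_fst_coordinate [continuous_intros]:
  "continuous_on S f \<Longrightarrow> continuous_on S (\<lambda>x. fst (f x) i)"
  by (rule continuous_on_product_then_coordinatewise) (rule continuous_on_fst)

lemma continuous_on_snd_coordinate [continuous_intros]:
  "continuous_on S f \<Longrightarrow> continuous_on S (\<lambda>x. snd (f x) i)"
  by (rule continuous_on_product_then_coordinatewise) (rule continuous_on_snd)

lemma continuous_on_if_const:
  "\<lbrakk>b \<Longrightarrow> continuous_on S f; \<not> b \<Longrightarrow> continuous_on S g\<rbrakk> \<Longrightarrow> continuous_on S (\<lambda>x. if b then f x else g x)"
  by (cases b) auto

text \<open>Moving the coordinate \<open>t i\<close> to the parameters turns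
  \<open>cube m \<times> cube (Suc k)\<close> into \<open>cube (Suc m) \<times> cube k\<close> and
  the slices into fibres, to which \<open>FAP k\<close> with one more parameter applies.\<close>

lemma hyperplane_slice_dense:
  assumes F: "FAP k M" and e: "e > 0" and i: "i \<le> k"
    and f: "continuous_map (top_of_set (cube m \<times> cube (Suc k))) (mtopology_of M) f"
  obtains f' where "eps_homotopic M (cube m \<times> cube (Suc k)) e f f'"
    "\<And>z s. \<lbrakk>z \<in> cube m; s \<in> {0..1}\<rbrakk> \<Longrightarrow> mdim_le M (f' ` ({z} \<times> {t \<in> cube (Suc k). t i = s})) k"
proof -
  \<comment> \<open>\<open>\<alpha>\<close> puts \<open>t i\<close> at index \<open>m\<close> of the
    parameter and closes the gap in \<open>t\<close>; \<open>\<beta>\<close> undoes this and resets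
    index \<open>m\<close> to \<open>0\<close>, since points of \<open>cube m\<close> vanish
    there.\<close>
  define \<alpha> :: "(nat \<Rightarrow> real) \<times> (nat \<Rightarrow> real) \<Rightarrow> _" where
    "\<alpha> x = ((\<lambda>j. if j = m then snd x i else fst x j), (\<lambda>j. if j < i then snd x j else snd x (Suc j)))" for x
  define \<beta> :: "(nat \<Rightarrow> real) \<times> (nat \<Rightarrow> real) \<Rightarrow> _" where
    "\<beta> y = ((\<lambda>j. if j = m then 0 else fst y j),
       (\<lambda>j. if j < i then snd y j else if j = i then fst y m else snd y (j - 1)))" for y
  have c\<alpha>: "continuous_on S \<alpha>" for S
    unfolding \<alpha>_def
    by (intro continuous_on_Pair continuous_on_coordinatewise_then_product continuous_on_if_const
        continuous_on_fst_coordinate continuous_on_snd_coordinate continuous_on_id)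
  have c\<beta>: "continuous_on S \<beta>" for S
    unfolding \<beta>_def
    by (intro continuous_on_Pair continuous_on_coordinatewise_then_product continuous_on_if_const
        continuous_on_fst_coordinate continuous_on_snd_coordinate continuous_on_id continuous_on_const)
  have \<alpha>: "\<alpha> x \<in> cube (Suc m) \<times> cube k" if "x \<in> cube m \<times> cube (Suc k)" for x
    using that i unfolding \<alpha>_def cube_def by auto
  have \<beta>: "\<beta> y \<in> cube m \<times> cube (Suc k)" if "y \<in> cube (Suc m) \<times> cube k" for y
    using that i unfolding \<beta>_def cube_def by auto
  have \<beta>\<alpha>: "\<beta> (\<alpha> x) = x" if "x \<in> cube m \<times> cube (Suc k)" for x
    using that i unfolding \<alpha>_def \<beta>_def cube_def by (auto simp: fun_eq_iff prod_eq_iff)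
  have "continuous_map (top_of_set (cube (Suc m) \<times> cube k)) (mtopology_of M) (\<lambda>y. f (\<beta> y))"
    by (rule continuous_map_top_of_set_compose[OF f c\<beta> \<beta>])
  then obtain g' where g': "eps_homotopic M (cube (Suc m) \<times> cube k) e (\<lambda>y. f (\<beta> y)) g'"
    "\<And>z. z \<in> cube (Suc m) \<Longrightarrow> mdim_le M (g' ` ({z} \<times> cube k)) k"
    using FAP_D[OF F e] by metis
  show thesis
  proof (rule that)
    show "eps_homotopic M (cube m \<times> cube (Suc k)) e f (\<lambda>x. g' (\<alpha> x))"
      by (rule eps_homotopic_compose[OF g'(1) c\<alpha> \<alpha>]) (use \<beta>\<alpha> in auto)
    fix z :: "nat \<Rightarrow> real" and s :: real assume z: "z \<in> cube m" and s: "s \<in> {0..1}"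
    let ?w = "\<lambda>j. if j = m then s else z j"
    have w: "?w \<in> cube (Suc m)" using z s by (auto simp: cube_def)
    have "\<alpha> ` ({z} \<times> {t \<in> cube (Suc k). t i = s}) = {?w} \<times> cube k" (is "?L = ?R")
    proof
      show "?L \<subseteq> ?R" using \<alpha> z by (auto simp: \<alpha>_def)
      show "?R \<subseteq> ?L"
      proof
        fix y assume "y \<in> ?R"
        then obtain r where r: "y = (?w, r)" "r \<in> cube k" by blast
        let ?t = "\<lambda>j. if j < i then r j else if j = i then s else r (j - 1)"
        have "?t \<in> cube (Suc k)" using r i s by (auto simp: cube_def)
        moreover have "\<alpha> (z, ?t) = y" using r by (auto simp: \<alpha>_def fun_eq_iff)
        ultimately show "y \<in> ?L" by (intro image_eqI[of _ _ "(z, ?t)"]) auto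
      qed
    qed
    then have "(\<lambda>x. g' (\<alpha> x)) ` ({z} \<times> {t \<in> cube (Suc k). t i = s}) = g' ` ({?w} \<times> cube k)"
      by (simp flip: image_image)
    then show "mdim_le M ((\<lambda>x. g' (\<alpha> x)) ` ({z} \<times> {t \<in> cube (Suc k). t i = s})) k"
      using g'(2)[OF w] by simp
  qed
qed

lemma compact_hyperplane: "compact {t \<in> cube k. t i = s}"
proof -
  have "closed {t :: nat \<Rightarrow> real. t i = s}"
    by (intro closed_Collect_eq continuous_on_product_coordinates continuous_on_const)
  then have "compact (cube k \<inter> {t. t i = s})" using compact_cube by (rule compact_Int_closed[rotated])
  then show ?thesis by (simp add: Collect_conj_eq)
qed

text \<open>There is one condition for each direction \<open>i\<close> and each scale, hence
  countably many; all \<open>z\<close> and \<open>s\<close> are handled at once since they range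
  over a compact set. Each condition is open by \<open>edim_le_stable\<close> and can be met by
  \<open>hyperplane_slice_dense\<close>.\<close>

lemma all_hyperplane_slices:
  assumes M: "mcomplete_of M" and F: "FAP k M" and e: "e > 0"
    and f: "continuous_map (top_of_set (cube m \<times> cube (Suc k))) (mtopology_of M) f"
  obtains f' where "eps_homotopic M (cube m \<times> cube (Suc k)) e f f'"
    "\<And>i z s. \<lbrakk>i \<le> k; z \<in> cube m; s \<in> {0..1}\<rbrakk> \<Longrightarrow> mdim_le M (f' ` ({z} \<times> {t \<in> cube (Suc k). t i = s})) k"
proof -
  let ?C = "cube m \<times> cube (Suc k)"
  let ?P = "cube m \<times> {0..1::real}"
  define R :: "nat \<Rightarrow> (nat \<Rightarrow> real) \<times> real \<Rightarrow> _" where "R i p = {fst p} \<times> {t \<in> cube (Suc k). t i = snd p}" for i p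
  have cP: "compact ?P" using compact_cube by (intro compact_Times) auto
  have RC: "R i p \<subseteq> ?C" if "p \<in> ?P" for i p using that by (auto simp: R_def)
  have cR: "compact (R i p)" for i p unfolding R_def by (intro compact_Times compact_hyperplane) auto
  have cS: "compact (Sigma ?P (R i))" for i
  proof -
    have "Sigma ?P (R i) = (?P \<times> ?C) \<inter> ({q. fst (fst q) = fst (snd q)} \<inter> {q. snd (snd q) i = snd (fst q)})"
      by (auto simp: R_def)
    moreover have "closed ({q :: ((nat \<Rightarrow> real) \<times> real) \<times> (nat \<Rightarrow> real) \<times> (nat \<Rightarrow> real). fst (fst q) = fst (snd q)}
        \<inter> {q. snd (snd q) i = snd (fst q)})"
      by (intro closed_Int closed_Collect_eq continuous_intros)
    ultimately show ?thesis using cP compact_cube by (auto intro!: compact_Int_closed compact_Times)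
  qed
  \<comment> \<open>A single index \<open>n\<close> encodes the direction as
    \<open>n mod Suc k\<close> and the scale by \<open>n div Suc k\<close>.\<close>
  define Q where "Q n g \<longleftrightarrow> (\<forall>p\<in>?P. edim_le M (1 / Suc (n div Suc k)) k (g ` R (n mod Suc k) p))" for n g
  have stable: "\<exists>d>0. \<forall>f'. continuous_map (top_of_set ?C) (mtopology_of M) f' \<longrightarrow>
               (\<forall>x\<in>?C. mdist M (f x) (f' x) \<le> d) \<longrightarrow> Q j f'"
    if "continuous_map (top_of_set ?C) (mtopology_of M) f" "Q j f" for j f
    unfolding Q_def
    by (rule edim_le_stable[OF that(1) cP cS RC]) (use that(2) in \<open>auto simp: Q_def\<close>)
  have dense: "\<exists>f'. eps_homotopic M ?C e f f' \<and> Q j f'"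
    if f: "continuous_map (top_of_set ?C) (mtopology_of M) f" and "e > 0" for j f e
  proof -
    have jm: "j mod Suc k \<le> k" by (simp flip: less_Suc_eq_le)
    obtain f' where f': "eps_homotopic M ?C e f f'"
      "\<And>z s. \<lbrakk>z \<in> cube m; s \<in> {0..1}\<rbrakk> \<Longrightarrow> mdim_le M (f' ` ({z} \<times> {t \<in> cube (Suc k). t (j mod Suc k) = s})) k"
      by (fact hyperplane_slice_dense[OF F \<open>e > 0\<close> jm f])
    have "edim_le M (1 / Suc (j div Suc k)) k (f' ` R (j mod Suc k) p)" if p: "p \<in> ?P" for p
    proof (rule mdim_le_imp_edim_le)
      show "compactin (mtopology_of M) (f' ` R (j mod Suc k) p)"
        by (rule compactin_image_top_of_set[OF eps_homotopic_continuous_map(2)[OF f'(1)] cR RC[OF p]])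
      show "mdim_le M (f' ` R (j mod Suc k) p) k"
        unfolding R_def using p by (intro f'(2)) auto
    qed simp
    then show ?thesis using f'(1) unfolding Q_def by blast
  qed
  obtain f' where f': "eps_homotopic M ?C e f f'" "\<And>j. Q j f'"
    by (rule eps_homotopic_Baire[where Q=Q, OF M stable dense f e]) (assumption | rule that)+
  show thesis
  proof (rule that[OF f'(1)])
    fix i z and s :: real assume i: "i \<le> k" and z: "z \<in> cube m" and s: "s \<in> {0..1}"
    then have p: "(z,s) \<in> ?P" by auto
    have "mdim_le M (f' ` R i (z,s)) k"
    proof (rule edim_le_inverse_Suc_imp_mdim_le)
      show "compactin (mtopology_of M) (f' ` R i (z,s))"
        by (rule compactin_image_top_of_set[OF eps_homotopic_continuous_map(2)[OF f'(1)] cR RC[OF p]])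
      show "edim_le M (1 / Suc j) k (f' ` R i (z,s))" for j
      proof -
        have "(i + j * Suc k) div Suc k = j" "(i + j * Suc k) mod Suc k = i"
          using i by (simp_all del: mult_Suc_right)
        then show ?thesis using f'(2)[of "i + j * Suc k"] p unfolding Q_def by metis
      qed
    qed
    then show "mdim_le M (f' ` ({z} \<times> {t \<in> cube (Suc k). t i = s})) k" by (simp add: R_def)
  qed
qed

section \<open>Local modifications\<close>

text \<open>The maximum distance in the first \<open>m\<close> coordinates. Its balls are cubes, so
  their faces lie in coordinate hyperplanes and can be compared with slices.\<close>

primrec supdist :: "nat \<Rightarrow> (nat \<Rightarrow> real) \<Rightarrow> (nat \<Rightarrow> real) \<Rightarrow> real" where
  "supdist 0 u v = 0"
| "supdist (Suc m) u v = max (supdist m u v) \<bar>u m - v m\<bar>"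

lemma supdist_nonneg: "0 \<le> supdist m u v"
  by (induction m) auto

lemma supdist_refl: "supdist m u u = 0"
  by (induction m) auto

lemma supdist_ge: "i < m \<Longrightarrow> \<bar>u i - v i\<bar> \<le> supdist m u v"
  by (induction m) (auto simp: less_Suc_eq le_max_iff_disj)

lemma supdist_le: "\<lbrakk>0 \<le> r; \<And>i. i < m \<Longrightarrow> \<bar>u i - v i\<bar> \<le> r\<rbrakk> \<Longrightarrow> supdist m u v \<le> r"
  by (induction m) auto

lemma supdist_attained: "0 < m \<Longrightarrow> \<exists>i<m. supdist m u v = \<bar>u i - v i\<bar>"
proof (induction m)
  case (Suc m)
  then show ?case by (cases "m = 0") (auto simp: max_def less_Suc_eq)
qed simp

lemma supdist_eq_0_imp_eq:
  assumes "u \<in> cube m" "v \<in> cube m" "supdist m u v \<le> 0"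
  shows "u = v"
proof
  fix i
  show "u i = v i"
  proof (cases "i < m")
    case True
    then show ?thesis using supdist_ge[OF True, of u v] assms(3) by linarith
  qed (use assms in \<open>auto simp: cube_def\<close>)
qed

lemma continuous_on_supdist [continuous_intros]:
  assumes "continuous_on S f" "continuous_on S g"
  shows "continuous_on S (\<lambda>x. supdist m (f x) (g x))"
proof -
  have "continuous_on S (\<lambda>x. f x i)" "continuous_on S (\<lambda>x. g x i)" for i
    using assms by (auto intro: continuous_on_product_then_coordinatewise)
  then show ?thesis by (induction m) (auto intro!: continuous_intros)
qed

text \<open>With the sum of the two distances, the part of a ball over \<open>z\<close> is a cube
  whose radius shrinks to nothing as \<open>z\<close> moves away from the centre. With the maximum,
  over a boundary parameter a whole cube would belong to the boundary.\<close>

definition boxdist :: "nat \<Rightarrow> nat \<Rightarrow> (nat \<Rightarrow> real) \<times> (nat \<Rightarrow> real) \<Rightarrow> (nat \<Rightarrow> real) \<times> (nat \<Rightarrow> real) \<Rightarrow> real" where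
  "boxdist m k x y = supdist m (fst x) (fst y) + supdist k (snd x) (snd y)"

lemma continuous_on_boxdist [continuous_intros]:
  assumes "continuous_on S f" "continuous_on S g"
  shows "continuous_on S (\<lambda>x. boxdist m k (f x) (g x))"
  unfolding boxdist_def using assms by (intro continuous_intros)

text \<open>The pairs with images at least \<open>e\<close> apart form a compact set
  \<open>K\<close> disjoint from the diagonal, so \<open>boxdist\<close> has a positive minimum on
  it unless it is empty.\<close>

lemma uniformly_continuous_boxdist:
  assumes f: "continuous_map (top_of_set (cube m \<times> cube k)) (mtopology_of M) f" and e: "e > 0"
  obtains d where "d > 0"
    "\<And>x y. \<lbrakk>x \<in> cube m \<times> cube k; y \<in> cube m \<times> cube k; boxdist m k x y \<le> d\<rbrakk> \<Longrightarrow> mdist M (f x) (f y) < e"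
proof -
  let ?C = "cube m \<times> cube k"
  have cC: "compact ?C" by (intro compact_Times compact_cube)
  have "continuous_map (top_of_set (?C \<times> ?C)) euclideanreal (\<lambda>z. mdist M (f (fst z)) (f (snd z)))"
    by (intro continuous_map_mdist continuous_map_top_of_set_compose[OF f])
       (auto intro!: continuous_intros)
  then have cont: "continuous_on (?C \<times> ?C) (\<lambda>z. mdist M (f (fst z)) (f (snd z)))"
    by simp
  define K where "K = {z \<in> ?C \<times> ?C. e \<le> mdist M (f (fst z)) (f (snd z))}"
  have "closedin (top_of_set (?C \<times> ?C)) K"
    using continuous_closedin_preimage[OF cont, of "{e..}"] by (simp add: K_def vimage_def Int_def)
  then have cK: "compact K" by (rule closedin_compact[OF compact_Times[OF cC cC]])
  show thesis
  proof (cases "K = {}")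
    case True
    show thesis by (rule that[of 1]) (use True in \<open>force simp: K_def\<close>)+
  next
    case False
    have "continuous_on K (\<lambda>z. boxdist m k (fst z) (snd z))" by (intro continuous_intros)
    then obtain z where z: "z \<in> K" "\<And>w. w \<in> K \<Longrightarrow> boxdist m k (fst z) (snd z) \<le> boxdist m k (fst w) (snd w)"
      using continuous_attains_inf[OF cK False] by blast
    have pos: "boxdist m k (fst z) (snd z) > 0"
    proof (rule ccontr)
      assume n: "\<not> ?thesis"
      have zC: "fst z \<in> ?C" "snd z \<in> ?C" using z(1) by (auto simp: K_def)
      have "supdist m (fst (fst z)) (fst (snd z)) \<le> 0" "supdist k (snd (fst z)) (snd (snd z)) \<le> 0"
        using n supdist_nonneg[of m "fst (fst z)" "fst (snd z)"] supdist_nonneg[of k "snd (fst z)" "snd (snd z)"]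
        unfolding boxdist_def by linarith+
      then have "fst z = snd z"
        using zC by (intro prod_eqI supdist_eq_0_imp_eq) auto
      moreover have "f (snd z) \<in> mspace M" using f zC(2) by (auto simp: continuous_map_def)
      ultimately have "mdist M (f (fst z)) (f (snd z)) = 0" by simp
      then show False using z(1) e by (simp add: K_def)
    qed
    show thesis
    proof (rule that[of "boxdist m k (fst z) (snd z) / 2"])
      fix x y assume x: "x \<in> ?C" "y \<in> ?C" "boxdist m k x y \<le> boxdist m k (fst z) (snd z) / 2"
      then have "(x,y) \<notin> K" using z(2)[of "(x,y)"] pos by auto
      then show "mdist M (f x) (f y) < e" using x by (auto simp: K_def)
    qed (use pos in simp)
  qed
qed

section \<open>Boxes around a point of the cube\<close>

definition clamp01 :: "real \<Rightarrow> real" where "clamp01 r = max 0 (min 1 r)"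

lemma clamp01: "0 \<le> clamp01 r" "clamp01 r \<le> 1"
  by (auto simp: clamp01_def)

lemma clamp01_id: "0 \<le> r \<Longrightarrow> r \<le> 1 \<Longrightarrow> clamp01 r = r"
  by (simp add: clamp01_def)

lemma clamp01_contract: "0 \<le> q \<Longrightarrow> q \<le> 1 \<Longrightarrow> \<bar>q - clamp01 r\<bar> \<le> \<bar>q - r\<bar>"
  by (auto simp: clamp01_def)

lemma continuous_on_clamp01 [continuous_intros]:
  "continuous_on S f \<Longrightarrow> continuous_on S (\<lambda>x. clamp01 (f x))"
  unfolding clamp01_def by (intro continuous_intros)

text \<open>\<open>box_in\<close> parametrises the part of the cube within sup-distance \<open>r\<close> of \<open>q\<close> by the whole cube;
  \<open>box_out\<close> is a right inverse over that part.\<close>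

definition box_in :: "nat \<Rightarrow> real \<Rightarrow> (nat \<Rightarrow> real) \<Rightarrow> (nat \<Rightarrow> real) \<Rightarrow> nat \<Rightarrow> real" where
  "box_in m r q y = (\<lambda>i. if i < m then clamp01 (q i + r * (2 * y i - 1)) else 0)"

definition box_out :: "nat \<Rightarrow> real \<Rightarrow> (nat \<Rightarrow> real) \<Rightarrow> (nat \<Rightarrow> real) \<Rightarrow> nat \<Rightarrow> real" where
  "box_out m r q y = (\<lambda>i. if i < m then clamp01 ((y i - q i + r) / (2 * r)) else 0)"

lemma box_in_cube: "box_in m r q y \<in> cube m"
  by (auto simp: box_in_def cube_def clamp01)

lemma box_out_cube: "box_out m r q y \<in> cube m"
  by (auto simp: box_out_def cube_def clamp01)

lemma supdist_box_in:
  assumes "q \<in> cube m" "y \<in> cube m" "0 < r"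
  shows "supdist m (box_in m r q y) q \<le> r"
proof (rule supdist_le)
  fix i assume i: "i < m"
  have q: "0 \<le> q i" "q i \<le> 1" and y: "0 \<le> y i" "y i \<le> 1" using assms i by (auto simp: cube_def)
  have "\<bar>q i - clamp01 (q i + r * (2 * y i - 1))\<bar> \<le> \<bar>r * (2 * y i - 1)\<bar>"
    using clamp01_contract[OF q, of "q i + r * (2 * y i - 1)"] by simp
  also have "\<dots> = r * \<bar>2 * y i - 1\<bar>" using assms(3) by (simp add: abs_mult)
  also have "\<dots> \<le> r" using assms(3) y by (intro mult_left_le) auto
  finally show "\<bar>box_in m r q y i - q i\<bar> \<le> r" using i by (simp add: box_in_def abs_minus_commute)
qed (use assms in simp)

lemma box_in_out:
  assumes "y \<in> cube m" "0 < r" "supdist m y q \<le> r"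
  shows "box_in m r q (box_out m r q y) = y"
proof
  fix i
  show "box_in m r q (box_out m r q y) i = y i"
  proof (cases "i < m")
    case True
    have y: "0 \<le> y i" "y i \<le> 1" using assms True by (auto simp: cube_def)
    have d: "\<bar>y i - q i\<bar> \<le> r" using supdist_ge[OF True, of y q] assms(3) by linarith
    have "clamp01 ((y i - q i + r) / (2 * r)) = (y i - q i + r) / (2 * r)"
      using d assms(2) by (intro clamp01_id) (auto simp: field_simps)
    moreover have "q i + r * (2 * ((y i - q i + r) / (2 * r)) - 1) = y i"
      using assms(2) by (simp add: field_simps)
    ultimately show ?thesis using True y clamp01_id by (simp add: box_in_def box_out_def)
  qed (use assms in \<open>auto simp: cube_def box_in_def\<close>)
qed

lemma continuous_on_box:
  assumes "continuous_on S f" "0 < r"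
  shows "continuous_on S (\<lambda>x. box_in m r q (f x))" "continuous_on S (\<lambda>x. box_out m r q (f x))"
proof -
  have c: "continuous_on S (\<lambda>x. f x i)" for i
    using assms by (auto intro: continuous_on_product_then_coordinatewise)
  show "continuous_on S (\<lambda>x. box_in m r q (f x))"
    unfolding box_in_def
    by (intro continuous_on_coordinatewise_then_product continuous_on_if_const)
       (use c in \<open>auto intro!: continuous_intros\<close>)
  show "continuous_on S (\<lambda>x. box_out m r q (f x))"
    unfolding box_out_def
    by (intro continuous_on_coordinatewise_then_product continuous_on_if_const)
       (use c assms(2) in \<open>auto intro!: continuous_intros\<close>)
qed

section \<open>Deforming a map near prescribed points\<close>

lemma eps_homotopic_submetric:
  assumes "eps_homotopic (submetric M U) C e f g"
  shows "eps_homotopic M C e f g"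
  using assms unfolding eps_homotopic_def
  by (auto simp: mtopology_of_submetric continuous_map_in_subtopology)

lemma mdim_le_submetric:
  assumes "A \<subseteq> U"
  shows "mdim_le (submetric M U) A k = mdim_le M A k"
  using assms unfolding mdim_le_def
  by (simp add: mtopology_of_submetric subtopology_subtopology Int_absorb1)

text \<open>\<open>FAP k\<close> of \<open>U\<close> is applied to \<open>f\<close> rescaled from a
  box around \<open>c\<close>, and the resulting homotopy is transplanted back, stopped earlier and
  earlier towards distance \<open>\<rho>\<close>. In the core, up to distance
  \<open>\<rho> - \<eta>\<close>, it runs to its end, where the fibres have images of dimension at
  most \<open>k\<close>. The collar in between has no dimension control.\<close>

lemma modify_near_point:
  assumes f: "continuous_map (top_of_set (cube m \<times> cube k)) (mtopology_of M) f"
    and U: "FAP k (submetric M U)"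
    and c: "c \<in> cube m \<times> cube k" and \<rho>: "0 < \<rho>" and \<eta>: "0 < \<eta>" and \<delta>: "0 < \<delta>"
    and fU: "\<And>x. \<lbrakk>x \<in> cube m \<times> cube k; boxdist m k x c \<le> 2 * \<rho>\<rbrakk> \<Longrightarrow> f x \<in> U"
  obtains f' A where "eps_homotopic M (cube m \<times> cube k) \<delta> f f'"
    "\<And>z. z \<in> cube m \<Longrightarrow> compactin (mtopology_of M) (A z) \<and> mdim_le M (A z) k"
    "\<And>x. \<lbrakk>x \<in> cube m \<times> cube k; \<rho> \<le> boxdist m k x c\<rbrakk> \<Longrightarrow> f' x = f x"
    "\<And>z t. \<lbrakk>z \<in> cube m; t \<in> cube k; boxdist m k (z,t) c \<le> \<rho> - \<eta>\<rbrakk> \<Longrightarrow> f' (z,t) \<in> A z"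
proof -
  let ?C = "cube m \<times> cube k"
  obtain q p where qp: "c = (q,p)" "q \<in> cube m" "p \<in> cube k" using c by auto
  define \<Phi> where "\<Phi> x = (box_in m \<rho> q (fst x), box_in k \<rho> p (snd x))" for x
  define \<Psi> where "\<Psi> x = (box_out m \<rho> q (fst x), box_out k \<rho> p (snd x))" for x
  have c\<Phi>: "continuous_on S \<Phi>" and c\<Psi>: "continuous_on S \<Psi>" for S
    unfolding \<Phi>_def \<Psi>_def by (intro continuous_on_Pair continuous_on_box continuous_intros \<rho>)+
  have \<Phi>C: "\<Phi> x \<in> ?C" and \<Psi>C: "\<Psi> x \<in> ?C" for x
    unfolding \<Phi>_def \<Psi>_def by (auto simp: box_in_cube box_out_cube)
  have \<Phi>\<Psi>: "\<Phi> (\<Psi> x) = x" if "x \<in> ?C" "boxdist m k x c \<le> \<rho>" for x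
  proof -
    have "supdist m (fst x) q \<le> \<rho>" "supdist k (snd x) p \<le> \<rho>"
      using that(2) supdist_nonneg[of m "fst x" q] supdist_nonneg[of k "snd x" p]
      unfolding boxdist_def qp by auto
    then show ?thesis using that(1) \<rho> unfolding \<Phi>_def \<Psi>_def by (auto simp: box_in_out)
  qed
  have fM: "f x \<in> mspace M" if "x \<in> ?C" for x using f that by (auto simp: continuous_map_def)
  have "continuous_map (top_of_set ?C) (mtopology_of M) (\<lambda>x. f (\<Phi> x))"
    by (rule continuous_map_top_of_set_compose[OF f c\<Phi> \<Phi>C])
  \<comment> \<open>The box is a product of two sup-balls of radius \<open>\<rho>\<close>, so its
    points may have \<open>boxdist\<close> up to \<open>2 * \<rho>\<close> from
    \<open>c\<close>.\<close>
  moreover have "f (\<Phi> x) \<in> U" if x: "x \<in> ?C" for x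
  proof (rule fU[OF \<Phi>C])
    show "boxdist m k (\<Phi> x) c \<le> 2 * \<rho>"
      using supdist_box_in[OF qp(2) _ \<rho>, of "fst x"] supdist_box_in[OF qp(3) _ \<rho>, of "snd x"] x
      by (auto simp: boxdist_def \<Phi>_def qp)
  qed
  ultimately have "continuous_map (top_of_set ?C) (mtopology_of (submetric M U)) (\<lambda>x. f (\<Phi> x))"
    by (auto simp: mtopology_of_submetric continuous_map_in_subtopology)
  then obtain G where G: "eps_homotopic (submetric M U) ?C \<delta> (\<lambda>x. f (\<Phi> x)) G"
    "\<And>z. z \<in> cube m \<Longrightarrow> mdim_le (submetric M U) (G ` ({z} \<times> cube k)) k"
    using FAP_D[OF U \<delta>] by metis
  have GU: "G x \<in> U" if "x \<in> ?C" for x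
    using eps_homotopic_continuous_map(2)[OF G(1)] that by (auto simp: continuous_map_def)
  have Gh: "eps_homotopic M ?C \<delta> (\<lambda>x. f (\<Phi> x)) G" using eps_homotopic_submetric[OF G(1)] .
  have dG: "mdim_le M (G ` ({z} \<times> cube k)) k" if "z \<in> cube m" for z
    using G(2)[OF that] mdim_le_submetric[of "G ` ({z} \<times> cube k)" U M k] GU that by blast
  obtain h where h: "continuous_map (top_of_set (?C \<times> {0..1::real})) (mtopology_of M) h"
    "\<And>x. x \<in> ?C \<Longrightarrow> h (x, 0) = f (\<Phi> x)" "\<And>x. x \<in> ?C \<Longrightarrow> h (x, 1) = G x"
    "\<And>x s t. \<lbrakk>x \<in> ?C; s \<in> {0..1}; t \<in> {0..1}\<rbrakk> \<Longrightarrow> mdist M (h (x, s)) (h (x, t)) \<le> \<delta>"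
    by (fact eps_homotopicE[OF Gh])
  \<comment> \<open>The fraction of the homotopy to be run: \<open>1\<close> on the core and
    \<open>0\<close> from distance \<open>\<rho>\<close> on, so that \<open>H\<close> fits together
    with \<open>f\<close> there.\<close>
  define l where "l x = clamp01 ((\<rho> - boxdist m k x c) / \<eta>)" for x
  have l01: "l x \<in> {0..1}" for x by (auto simp: l_def clamp01)
  have ul: "u * l x \<in> {0..1}" if "u \<in> {0..1}" for u x
    using that l01[of x] by (auto intro: mult_le_one)
  define H where "H w = (if boxdist m k (fst w) c \<le> \<rho> then h (\<Psi> (fst w), snd w * l (fst w)) else f (fst w))" for w
  have H0: "H (x,0) = f x" if "x \<in> ?C" for x
    using h(2)[OF \<Psi>C] \<Phi>\<Psi>[OF that] by (simp add: H_def)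
  have lz: "l x = 0" if "\<rho> \<le> boxdist m k x c" for x
    unfolding l_def clamp01_def using that \<eta> by (simp add: divide_nonpos_pos)
  have cH: "continuous_map (top_of_set (?C \<times> {0..1::real})) (mtopology_of M) H"
    unfolding H_def
  proof (rule continuous_map_glue_le)
    show "continuous_map (top_of_set {w \<in> ?C \<times> {0..1}. boxdist m k (fst w) c \<le> \<rho>}) (mtopology_of M)
       (\<lambda>w. h (\<Psi> (fst w), snd w * l (fst w)))"
    proof (rule continuous_map_top_of_set_compose[OF h(1)])
      show "continuous_on {w \<in> ?C \<times> {0..1}. boxdist m k (fst w) c \<le> \<rho>} (\<lambda>w. (\<Psi> (fst w), snd w * l (fst w)))"
        unfolding l_def using \<eta> by (intro continuous_intros continuous_on_compose2[OF c\<Psi>[of UNIV]]) auto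
    qed (use \<Psi>C ul in auto)
    show "continuous_map (top_of_set {w \<in> ?C \<times> {0..1}. \<rho> \<le> boxdist m k (fst w) c}) (mtopology_of M) (\<lambda>w. f (fst w))"
      by (rule continuous_map_top_of_set_compose[OF f]) (auto intro!: continuous_intros)
    show "h (\<Psi> (fst w), snd w * l (fst w)) = f (fst w)" if "w \<in> ?C \<times> {0..1}" "boxdist m k (fst w) c = \<rho>" for w
      using h(2)[OF \<Psi>C] \<Phi>\<Psi>[of "fst w"] lz[of "fst w"] that by auto
  qed (auto intro!: continuous_intros)
  have dH: "mdist M (H (x,s)) (H (x,t)) \<le> \<delta>" if "x \<in> ?C" "s \<in> {0..1}" "t \<in> {0..1}" for x s t
  proof (cases "boxdist m k x c \<le> \<rho>")
    case True
    then show ?thesis using h(4)[OF \<Psi>C ul[OF that(2)] ul[OF that(3)]] by (simp add: H_def)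
  next
    case False
    have "mdist M (f x) (f x) = 0" using fM[OF that(1)] by simp
    then show ?thesis using False \<delta> by (simp add: H_def)
  qed
  show thesis
  \<comment> \<open>The first component of \<open>\<Psi>\<close> depends on \<open>z\<close> alone,
    so the whole core over \<open>z\<close> lands in the image of a single fibre under
    \<open>G\<close>.\<close>
  proof (rule that[of "\<lambda>x. H (x,1)" "\<lambda>z. G ` ({box_out m \<rho> q z} \<times> cube k)"])
    show "eps_homotopic M ?C \<delta> f (\<lambda>x. H (x,1))"
      unfolding eps_homotopic_def using cH H0 dH by (intro exI[of _ H]) auto
    show "compactin (mtopology_of M) (G ` ({box_out m \<rho> q z} \<times> cube k)) \<and>
        mdim_le M (G ` ({box_out m \<rho> q z} \<times> cube k)) k" for z
      using dG[OF box_out_cube]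
      by (auto intro!: compactin_image_top_of_set[OF eps_homotopic_continuous_map(2)[OF Gh]] compact_Times compact_cube box_out_cube)
    show "H (x,1) = f x" if "x \<in> ?C" "\<rho> \<le> boxdist m k x c" for x
      using h(2)[OF \<Psi>C] \<Phi>\<Psi>[OF that(1)] lz[OF that(2)] by (simp add: H_def)
    show "H ((z,t),1) \<in> G ` ({box_out m \<rho> q z} \<times> cube k)"
      if zt: "z \<in> cube m" "t \<in> cube k" "boxdist m k (z,t) c \<le> \<rho> - \<eta>" for z t
    proof -
      have "1 \<le> (\<rho> - boxdist m k (z,t) c) / \<eta>" using zt(3) \<eta> by (simp add: field_simps)
      then have "l (z,t) = 1" by (simp add: l_def clamp01_def)
      then have "H ((z,t),1) = G (\<Psi> (z,t))" using h(3)[OF \<Psi>C] zt(3) \<eta> by (simp add: H_def)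
      then show ?thesis by (simp add: \<Psi>_def box_out_cube)
    qed
  qed
qed

text \<open>The points of \<open>X\<close> are treated one after another. A point in some core and
  in no collar is sent to a low-dimensional set by the last modification whose core contains it, and
  later ones do not move it. The bound on \<open>card X * \<delta>\<close> keeps the intermediate
  maps close enough to \<open>f\<close> to remain in the given neighbourhoods.\<close>

lemma modify_near_points:
  fixes \<delta> :: real
  assumes f: "continuous_map (top_of_set (cube m \<times> cube k)) (mtopology_of M) f"
    and \<rho>: "0 < \<rho>" and \<eta>: "0 < \<eta>" and \<delta>: "0 < \<delta>"
    and unif: "\<And>x y. \<lbrakk>x \<in> cube m \<times> cube k; y \<in> cube m \<times> cube k; boxdist m k x y \<le> 2 * \<rho>\<rbrakk> \<Longrightarrow> mdist M (f x) (f y) < r/2"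
    and X: "finite X" "X \<subseteq> cube m \<times> cube k" "real (card X) * \<delta> < r/2"
    and loc: "\<And>c. c \<in> X \<Longrightarrow> \<exists>U. FAP k (submetric M U) \<and> mball_of M (f c) r \<subseteq> U"
  shows "\<exists>f' A. eps_homotopic M (cube m \<times> cube k) (card X * \<delta>) f f' \<and>
    (\<forall>z\<in>cube m. compactin (mtopology_of M) (A z) \<and> mdim_le M (A z) k) \<and>
    (\<forall>z\<in>cube m. \<forall>t\<in>cube k. (\<forall>c\<in>X. boxdist m k (z,t) c \<le> \<rho> - \<eta> \<or> \<rho> \<le> boxdist m k (z,t) c) \<longrightarrow>
        (\<exists>c\<in>X. boxdist m k (z,t) c \<le> \<rho> - \<eta>) \<longrightarrow> f' (z,t) \<in> A z)"
  using X loc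
proof (induction X rule: finite_induct)
  case empty
  show ?case
    by (rule exI[of _ f], rule exI[of _ "\<lambda>_. {}"]) (use f in \<open>auto intro: eps_homotopic_refl simp: mdim_le_empty\<close>)
next
  case (insert c X)
  let ?C = "cube m \<times> cube k"
  have card: "real (card (insert c X)) * \<delta> = real (card X) * \<delta> + \<delta>"
    using insert.hyps by (simp add: algebra_simps)
  then have cX: "real (card X) * \<delta> < r/2" using insert.prems(2) \<delta> by linarith
  have c: "c \<in> ?C" "X \<subseteq> ?C" using insert.prems(1) by auto
  obtain f' A where f': "eps_homotopic M ?C (card X * \<delta>) f f'"
    and A: "\<forall>z\<in>cube m. compactin (mtopology_of M) (A z) \<and> mdim_le M (A z) k"
    and fA: "\<forall>z\<in>cube m. \<forall>t\<in>cube k. (\<forall>c\<in>X. boxdist m k (z,t) c \<le> \<rho> - \<eta> \<or> \<rho> \<le> boxdist m k (z,t) c) \<longrightarrow>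
        (\<exists>c\<in>X. boxdist m k (z,t) c \<le> \<rho> - \<eta>) \<longrightarrow> f' (z,t) \<in> A z"
    using insert.IH[OF c(2) cX] insert.prems(3) by auto
  obtain U where U: "FAP k (submetric M U)" "mball_of M (f c) r \<subseteq> U" using insert.prems(3)[of c] by auto
  have cf': "continuous_map (top_of_set ?C) (mtopology_of M) f'" using eps_homotopic_continuous_map(2)[OF f'] .
  have fM: "f x \<in> mspace M" "f' x \<in> mspace M" if "x \<in> ?C" for x
    using f cf' that by (auto simp: continuous_map_def)
  \<comment> \<open>One \<open>r/2\<close> is spent on the distance from \<open>c\<close> to
    \<open>x\<close>, through \<open>unif\<close>, the other on the homotopies made so far.\<close>
  have fU: "f' x \<in> U" if x: "x \<in> ?C" "boxdist m k x c \<le> 2 * \<rho>" for x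
  proof -
    have "mdist M (f c) (f' x) \<le> mdist M (f c) (f x) + mdist M (f x) (f' x)"
      using fM x c by (intro mdist_triangle) auto
    also have "mdist M (f c) (f x) < r/2" using unif[OF x(1) c(1) x(2)] by (simp add: mdist_commute)
    also have "mdist M (f x) (f' x) \<le> card X * \<delta>" using eps_homotopic_dist[OF f' x(1)] .
    finally have "mdist M (f c) (f' x) < r" using cX by simp
    then show ?thesis using U(2) fM x c by (auto simp: mball_of_def Metric_space.in_mball)
  qed
  obtain f'' B where f'': "eps_homotopic M ?C \<delta> f' f''"
    and B: "\<And>z. z \<in> cube m \<Longrightarrow> compactin (mtopology_of M) (B z) \<and> mdim_le M (B z) k"
    and out: "\<And>x. \<lbrakk>x \<in> ?C; \<rho> \<le> boxdist m k x c\<rbrakk> \<Longrightarrow> f'' x = f' x"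
    and inn: "\<And>z t. \<lbrakk>z \<in> cube m; t \<in> cube k; boxdist m k (z,t) c \<le> \<rho> - \<eta>\<rbrakk> \<Longrightarrow> f'' (z,t) \<in> B z"
    by (rule modify_near_point[OF cf' U(1) c(1) \<rho> \<eta> \<delta>]) (erule (1) fU, rule that)
  show ?case
  proof (rule exI[of _ f''], rule exI[of _ "\<lambda>z. A z \<union> B z"], intro conjI ballI impI)
    show "eps_homotopic M ?C (card (insert c X) * \<delta>) f f''"
      unfolding card by (rule eps_homotopic_trans[OF f' f''])
    show "compactin (mtopology_of M) (A z \<union> B z)" if "z \<in> cube m" for z
      using A B that by (auto intro: compactin_Un)
    show "mdim_le M (A z \<union> B z) k" if "z \<in> cube m" for z
      using A B that by (auto intro: mdim_le_Un)
    fix z t assume z: "z \<in> cube m" and t: "t \<in> cube k"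
      and no: "\<forall>c\<in>insert c X. boxdist m k (z,t) c \<le> \<rho> - \<eta> \<or> \<rho> \<le> boxdist m k (z,t) c"
      and ex: "\<exists>c\<in>insert c X. boxdist m k (z,t) c \<le> \<rho> - \<eta>"
    show "f'' (z,t) \<in> A z \<union> B z"
    proof (cases "boxdist m k (z,t) c \<le> \<rho> - \<eta>")
      case True
      then show ?thesis using inn z t by blast
    next
      case False
      \<comment> \<open>Not being in the core of the new \<open>c\<close>, and in no collar, the
        point is at distance at least \<open>\<rho>\<close> and stays fixed in this step.\<close>
      then have "f'' (z,t) = f' (z,t)" using no out z t by blast
      moreover have "f' (z,t) \<in> A z" using fA z t no ex False by blast
      ultimately show ?thesis by simp
    qed
  qed
qed

text \<open>The order of the choices matters. First the slices get \<open>k\<close>-dimensional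
  images, so the images of the faces \<open>R z\<close> have neighbourhoods of a uniform size with
  good covers at scale \<open>d\<close>. Only then are the collar width \<open>\<eta>\<close> and
  the displacement chosen, small enough to keep the images of the collars in these
  neighbourhoods.\<close>

lemma fibre_edim_dense:
  assumes M: "mcomplete_of M" and F: "FAP k M"
    and loc: "\<And>y. y \<in> mspace M \<Longrightarrow>
      \<exists>U. U \<subseteq> mspace M \<and> y \<in> (mtopology_of M) interior_of U \<and> FAP (Suc k) (submetric M U)"
    and e: "e > 0" and d: "d > 0"
    and f: "continuous_map (top_of_set (cube m \<times> cube (Suc k))) (mtopology_of M) f"
  obtains f' where "eps_homotopic M (cube m \<times> cube (Suc k)) e f f'"
    "\<And>z. z \<in> cube m \<Longrightarrow> edim_le M d (Suc k) (f' ` ({z} \<times> cube (Suc k)))"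
proof -
  let ?C = "cube m \<times> cube (Suc k)"
  let ?D = "boxdist m (Suc k)"
  have cC: "compact ?C" by (intro compact_Times compact_cube)
  have e2: "e/2 > 0" using e by simp
  obtain g where g: "eps_homotopic M ?C (e/2) f g"
    "\<And>i z s. \<lbrakk>i \<le> k; z \<in> cube m; s \<in> {0..1}\<rbrakk> \<Longrightarrow> mdim_le M (g ` ({z} \<times> {t \<in> cube (Suc k). t i = s})) k"
    by (fact all_hyperplane_slices[OF M F e2 f])
  have cg: "continuous_map (top_of_set ?C) (mtopology_of M) g" using eps_homotopic_continuous_map(2)[OF g(1)] .
  have gM: "g x \<in> mspace M" if "x \<in> ?C" for x using cg that by (auto simp: continuous_map_def)
  define \<U> where "\<U> = {(mtopology_of M) interior_of U |U. U \<subseteq> mspace M \<and> FAP (Suc k) (submetric M U)}"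
  have cgC: "compactin (mtopology_of M) (g ` ?C)" by (rule compactin_image_top_of_set[OF cg cC]) simp
  have "y \<in> \<Union>\<U>" if "y \<in> mspace M" for y
    using loc[OF that] unfolding \<U>_def by blast
  then have covU: "g ` ?C \<subseteq> \<Union>\<U>" using gM by blast
  have opU: "openin (mtopology_of M) U" if "U \<in> \<U>" for U using that by (auto simp: \<U>_def)
  obtain r where r: "r > 0" "\<And>y. y \<in> g ` ?C \<Longrightarrow> \<exists>U\<in>\<U>. mball_of M y r \<subseteq> U"
    by (rule compactin_lebesgue_number[OF cgC covU]) (erule opU, rule that)
  have near: "\<exists>U. FAP (Suc k) (submetric M U) \<and> mball_of M (g c) r \<subseteq> U" if "c \<in> ?C" for c
  proof -
    obtain V where V: "V \<in> \<U>" "mball_of M (g c) r \<subseteq> V" using r(2)[of "g c"] \<open>c \<in> ?C\<close> by blast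
    then obtain U where U: "V = (mtopology_of M) interior_of U" "FAP (Suc k) (submetric M U)"
      by (auto simp: \<U>_def)
    then have "mball_of M (g c) r \<subseteq> U" using V(2) interior_of_subset[of "mtopology_of M" U] by simp
    then show ?thesis using U(2) by blast
  qed
  obtain \<rho>' where \<rho>': "\<rho>' > 0"
    "\<And>x y. \<lbrakk>x \<in> ?C; y \<in> ?C; ?D x y \<le> \<rho>'\<rbrakk> \<Longrightarrow> mdist M (g x) (g y) < r/2"
    using uniformly_continuous_boxdist[OF cg, of "r/2"] r(1) by auto
  \<comment> \<open>Halved because \<open>modify_near_points\<close> compares values up to distance
    \<open>2 * \<rho>\<close>.\<close>
  define \<rho> where "\<rho> = \<rho>'/2"
  have \<rho>: "\<rho> > 0" "\<And>x y. \<lbrakk>x \<in> ?C; y \<in> ?C; ?D x y \<le> 2 * \<rho>\<rbrakk> \<Longrightarrow> mdist M (g x) (g y) < r/2"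
    using \<rho>' by (auto simp: \<rho>_def)
  have op: "open {x. ?D x c < \<rho>/2}" for c
    by (intro open_Collect_less continuous_intros)
  have cov: "?C \<subseteq> (\<Union>c\<in>?C. {x. ?D x c < \<rho>/2})"
    using \<rho>(1) by (force simp: boxdist_def supdist_refl)
  \<comment> \<open>Covering with radius \<open>\<rho>/2\<close> and taking
    \<open>\<eta> \<le> \<rho>/2\<close> below puts every point into the core of some
    \<open>c\<close>.\<close>
  obtain X where X: "X \<subseteq> ?C" "finite X" "?C \<subseteq> (\<Union>c\<in>X. {x. ?D x c < \<rho>/2})"
    using compactE_image[OF cC op cov] by metis
  \<comment> \<open>One index for each face: direction, centre and side.\<close>
  define J where "J = {..k} \<times> X \<times> {-1, 1::real}"
  have finJ: "finite J" using X(2) by (simp add: J_def)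
  \<comment> \<open>The faces of the cube \<open>{t. boxdist (z,t) c \<le> \<rho>}\<close> lie in the hyperplanes \<open>t i = v (i,c,\<plusminus>1) z\<close>.\<close>
  define v where "v j z = (case j of (i, c, \<sigma>) \<Rightarrow> clamp01 (snd c i + \<sigma> * (\<rho> - supdist m z (fst c))))"
    for j :: "nat \<times> ((nat \<Rightarrow> real) \<times> (nat \<Rightarrow> real)) \<times> real" and z
  have v01: "v j z \<in> {0..1}" for j z by (auto simp: v_def clamp01 split: prod.split)
  have cv: "continuous_on S (\<lambda>x. v j (h x))" if "continuous_on S h" for S j and h :: "'b::topological_space \<Rightarrow> _"
    using that unfolding v_def by (cases j) (auto intro!: continuous_intros)
  define R where "R z = {z} \<times> {t \<in> cube (Suc k). \<exists>j\<in>J. t (fst j) = v j z}" for z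
  have RC: "R z \<subseteq> ?C" if "z \<in> cube m" for z using that by (auto simp: R_def)
  have cS: "compact (Sigma (cube m) R)"
  proof -
    have "Sigma (cube m) R = (cube m \<times> ?C) \<inter>
        ({w. fst w = fst (snd w)} \<inter> (\<Union>j\<in>J. {w. snd (snd w) (fst j) = v j (fst w)}))" (is "?L = ?R")
    proof (rule set_eqI)
      fix w :: "(nat \<Rightarrow> real) \<times> (nat \<Rightarrow> real) \<times> (nat \<Rightarrow> real)"
      obtain z z' t where w: "w = (z, z', t)" by (cases w)
      show "w \<in> ?L \<longleftrightarrow> w \<in> ?R" unfolding w R_def by (simp, blast)
    qed
    moreover have "closed ({w :: (nat \<Rightarrow> real) \<times> (nat \<Rightarrow> real) \<times> (nat \<Rightarrow> real). fst w = fst (snd w)} \<inter>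
        (\<Union>j\<in>J. {w. snd (snd w) (fst j) = v j (fst w)}))"
      by (intro closed_Int closed_UN finJ ballI closed_Collect_eq cv continuous_intros)
    ultimately show ?thesis using cC compact_cube by (auto intro!: compact_Int_closed compact_Times)
  qed
  have edR: "edim_le M d (Suc k) (g ` R z)" if z: "z \<in> cube m" for z
  proof -
    have "compactin (mtopology_of M) (g ` ({z} \<times> {t \<in> cube (Suc k). t (fst j) = v j z})) \<and>
        mdim_le M (g ` ({z} \<times> {t \<in> cube (Suc k). t (fst j) = v j z})) k" if "j \<in> J" for j
    proof
      show "compactin (mtopology_of M) (g ` ({z} \<times> {t \<in> cube (Suc k). t (fst j) = v j z}))"
        by (rule compactin_image_top_of_set[OF cg]) (use z in \<open>auto intro!: compact_Times compact_hyperplane\<close>)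
      show "mdim_le M (g ` ({z} \<times> {t \<in> cube (Suc k). t (fst j) = v j z})) k"
        by (rule g(2)) (use z v01 that in \<open>auto simp: J_def\<close>)
    qed
    then have "compactin (mtopology_of M) (\<Union>j\<in>J. g ` ({z} \<times> {t \<in> cube (Suc k). t (fst j) = v j z})) \<and>
        mdim_le M (\<Union>j\<in>J. g ` ({z} \<times> {t \<in> cube (Suc k). t (fst j) = v j z})) k"
      by (rule mdim_le_UN[OF finJ])
    then have "edim_le M d k (\<Union>j\<in>J. g ` ({z} \<times> {t \<in> cube (Suc k). t (fst j) = v j z}))"
      using mdim_le_imp_edim_le d by blast
    moreover have "(\<Union>j\<in>J. g ` ({z} \<times> {t \<in> cube (Suc k). t (fst j) = v j z})) = g ` R z"
      unfolding R_def by blast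
    ultimately show ?thesis by (simp add: edim_le_Suc)
  qed
  obtain \<delta>0 where \<delta>0: "\<delta>0 > 0" "\<And>z. z \<in> cube m \<Longrightarrow> \<exists>N. edim_le M d (Suc k) N \<and>
      (\<forall>x\<in>R z. \<forall>y\<in>mspace M. mdist M (g x) y < \<delta>0 \<longrightarrow> y \<in> N)"
    by (rule edim_le_uniform[OF cg compact_cube cS RC edR]) (assumption, assumption, rule that)
  obtain \<eta>' where \<eta>': "\<eta>' > 0"
    "\<And>x y. \<lbrakk>x \<in> ?C; y \<in> ?C; ?D x y \<le> \<eta>'\<rbrakk> \<Longrightarrow> mdist M (g x) (g y) < \<delta>0/2"
    using uniformly_continuous_boxdist[OF cg, of "\<delta>0/2"] \<delta>0(1) by auto
  define \<eta> where "\<eta> = min \<eta>' (\<rho>/2)"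
  have \<eta>: "\<eta> > 0" "\<eta> \<le> \<eta>'" "\<eta> \<le> \<rho>/2" using \<eta>'(1) \<rho>(1) by (auto simp: \<eta>_def)
  \<comment> \<open>\<open>b\<close> bounds the total displacement: \<open>r/2\<close> to stay in
    the neighbourhoods, \<open>e/2\<close> for the homotopy from \<open>f\<close>,
    \<open>\<delta>0/2\<close> for the collars. The \<open>+ 1\<close> in \<open>\<delta>\<close>
    makes \<open>card X * \<delta>\<close> strictly smaller than \<open>b\<close>.\<close>
  define b where "b = min (r/2) (min (e/2) (\<delta>0/2))"
  define \<delta> where "\<delta> = b / (real (card X) + 1)"
  have b: "b > 0" "b \<le> r/2" "b \<le> e/2" "b \<le> \<delta>0/2" using r(1) e \<delta>0(1) by (auto simp: b_def)
  have \<delta>: "\<delta> > 0" using b(1) by (simp add: \<delta>_def)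
  have cb: "real (card X) * \<delta> < b" using b(1) by (simp add: \<delta>_def field_simps)
  have "\<exists>f' A. eps_homotopic M ?C (card X * \<delta>) g f' \<and>
    (\<forall>z\<in>cube m. compactin (mtopology_of M) (A z) \<and> mdim_le M (A z) (Suc k)) \<and>
    (\<forall>z\<in>cube m. \<forall>t\<in>cube (Suc k). (\<forall>c\<in>X. ?D (z,t) c \<le> \<rho> - \<eta> \<or> \<rho> \<le> ?D (z,t) c) \<longrightarrow>
        (\<exists>c\<in>X. ?D (z,t) c \<le> \<rho> - \<eta>) \<longrightarrow> f' (z,t) \<in> A z)"
    by (rule modify_near_points[OF cg \<rho>(1) \<eta>(1) \<delta>, where r=r]) (use \<rho>(2) X cb b near in auto)
  then obtain f' A where f': "eps_homotopic M ?C (card X * \<delta>) g f'"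
    and A: "\<forall>z\<in>cube m. compactin (mtopology_of M) (A z) \<and> mdim_le M (A z) (Suc k)"
    and fA: "\<forall>z\<in>cube m. \<forall>t\<in>cube (Suc k). (\<forall>c\<in>X. ?D (z,t) c \<le> \<rho> - \<eta> \<or> \<rho> \<le> ?D (z,t) c) \<longrightarrow>
        (\<exists>c\<in>X. ?D (z,t) c \<le> \<rho> - \<eta>) \<longrightarrow> f' (z,t) \<in> A z"
    by (elim exE conjE) (rule that)
  have cf': "continuous_map (top_of_set ?C) (mtopology_of M) f'" using eps_homotopic_continuous_map(2)[OF f'] .
  show thesis
  proof (rule that)
    have "eps_homotopic M ?C (e/2 + card X * \<delta>) f f'" using eps_homotopic_trans[OF g(1) f'] .
    then show "eps_homotopic M ?C e f f'" by (rule eps_homotopic_mono) (use cb b in linarith)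
    fix z assume z: "z \<in> cube m"
    \<comment> \<open>A compact set that will contain every \<open>t\<close> lying in a collar over
      \<open>z\<close>.\<close>
    define T where "T = {t \<in> cube (Suc k). \<exists>j\<in>J. \<bar>t (fst j) - v j z\<bar> \<le> \<eta>}"
    have "compact T"
    proof -
      have "closed {t :: nat \<Rightarrow> real. \<bar>t (fst j) - v j z\<bar> \<le> \<eta>}" for j
        by (intro closed_Collect_le continuous_on_rabs continuous_on_diff continuous_on_product_coordinates continuous_on_const)
      then have "closed (\<Union>j\<in>J. {t :: nat \<Rightarrow> real. \<bar>t (fst j) - v j z\<bar> \<le> \<eta>})" using finJ by (intro closed_UN) auto
      moreover have "T = cube (Suc k) \<inter> (\<Union>j\<in>J. {t. \<bar>t (fst j) - v j z\<bar> \<le> \<eta>})" unfolding T_def by blast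
      ultimately show ?thesis by (simp add: compact_Int_closed compact_cube)
    qed
    then have cB: "compactin (mtopology_of M) (f' ` ({z} \<times> T))"
      by (intro compactin_image_top_of_set[OF cf'] compact_Times) (use z in \<open>auto simp: T_def\<close>)
    obtain N where N: "edim_le M d (Suc k) N" "\<forall>x\<in>R z. \<forall>y\<in>mspace M. mdist M (g x) y < \<delta>0 \<longrightarrow> y \<in> N"
      using \<delta>0(2)[OF z] by blast
    have "f' (z,t) \<in> N" if t: "t \<in> T" for t
    proof -
      obtain j where j: "j \<in> J" "\<bar>t (fst j) - v j z\<bar> \<le> \<eta>" and tc: "t \<in> cube (Suc k)" using t by (auto simp: T_def)
      \<comment> \<open>Moving one coordinate onto the hyperplane costs at most
        \<open>\<eta>\<close>, hence less than \<open>\<delta>0/2\<close> after applying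
        \<open>g\<close>; the displacement from \<open>g\<close> to \<open>f'\<close> stays within
        the other half.\<close>
      define t' where "t' = t(fst j := v j z)"
      have "fst j < Suc k" using j(1) by (auto simp: J_def)
      then have t'c: "t' \<in> cube (Suc k)" using tc v01[of j z] by (auto simp: t'_def cube_def)
      have t'R: "(z,t') \<in> R z" using t'c j(1) by (auto simp: R_def t'_def)
      have "supdist (Suc k) t' t \<le> \<eta>"
        by (rule supdist_le) (use \<eta>(1) j(2) in \<open>auto simp: t'_def abs_minus_commute\<close>)
      then have "?D (z,t') (z,t) \<le> \<eta>'" using \<eta>(2) by (simp only: boxdist_def fst_conv snd_conv supdist_refl)
      then have 1: "mdist M (g (z,t')) (g (z,t)) < \<delta>0/2" using z tc t'c by (intro \<eta>'(2)) auto
      have 2: "mdist M (g (z,t)) (f' (z,t)) \<le> card X * \<delta>" using z tc by (intro eps_homotopic_dist[OF f']) auto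
      have fm: "f' (z,t) \<in> mspace M" using cf' z tc by (auto simp: continuous_map_def)
      have "mdist M (g (z,t')) (f' (z,t)) \<le> mdist M (g (z,t')) (g (z,t)) + mdist M (g (z,t)) (f' (z,t))"
        using gM z tc t'c fm by (intro mdist_triangle) auto
      then have "mdist M (g (z,t')) (f' (z,t)) < \<delta>0" using 1 2 cb b(4) by linarith
      then show ?thesis using N(2) t'R fm by blast
    qed
    then have "edim_le M d (Suc k) (f' ` ({z} \<times> T))" by (intro edim_le_subset[OF N(1)]) blast
    \<comment> \<open>The cores contribute \<open>A z\<close>, of known dimension, and the collars a
      set controlled only at scale \<open>d\<close>, which is the asymmetric situation of
      \<open>edim_le_Un\<close>.\<close>
    then have "edim_le M d (Suc k) (A z \<union> f' ` ({z} \<times> T))"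
      using A z by (intro edim_le_Un cB d) auto
    moreover have "f' (z,t) \<in> A z \<union> f' ` ({z} \<times> T)" if t: "t \<in> cube (Suc k)" for t
    proof (cases "\<forall>c\<in>X. ?D (z,t) c \<le> \<rho> - \<eta> \<or> \<rho> \<le> ?D (z,t) c")
      case True
      obtain c where "c \<in> X" "?D (z,t) c < \<rho>/2" using X(3) z t by blast
      then have "\<exists>c\<in>X. ?D (z,t) c \<le> \<rho> - \<eta>" using \<eta>(3) by (intro bexI[of _ c]) auto
      then show ?thesis using fA z t True by blast
    next
      case False
      \<comment> \<open>In a collar, the sup-distance of \<open>t\<close> from the centre differs by
        at most \<open>\<eta>\<close> from \<open>\<rho> - supdist m z (fst c)\<close>. A coordinate
        attaining it, together with its sign, determines the face; clamping does not move the
        hyperplane away from \<open>t i\<close>.\<close>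
      then obtain c where c: "c \<in> X" "\<rho> - \<eta> < ?D (z,t) c" "?D (z,t) c < \<rho>" by force
      obtain i where i: "i < Suc k" "supdist (Suc k) t (snd c) = \<bar>t i - snd c i\<bar>"
        using supdist_attained[of "Suc k" t "snd c"] by blast
      define s :: real where "s = (if t i \<ge> snd c i then 1 else -1)"
      have ti: "0 \<le> t i" "t i \<le> 1" using t i by (auto simp: cube_def)
      have "?D (z,t) c = supdist m z (fst c) + \<bar>t i - snd c i\<bar>" using i(2) by (simp only: boxdist_def fst_conv snd_conv)
      then have "\<bar>t i - (snd c i + s * (\<rho> - supdist m z (fst c)))\<bar> \<le> \<eta>"
        using c(2,3) by (auto simp: s_def)
      then have "\<bar>t i - v (i,c,s) z\<bar> \<le> \<eta>"
        using clamp01_contract[OF ti, of "snd c i + s * (\<rho> - supdist m z (fst c))"] by (simp add: v_def)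
      moreover have "(i,c,s) \<in> J" using i c by (auto simp: J_def s_def)
      ultimately have "t \<in> T" using t by (force simp: T_def)
      then show ?thesis by blast
    qed
    ultimately show "edim_le M d (Suc k) (f' ` ({z} \<times> cube (Suc k)))"
      by (elim edim_le_subset) blast
  qed
qed

section \<open>The induction on the fibre dimension\<close>

lemma FAP_0: "FAP 0 M"
proof (rule FAP_I)
  fix e :: real and m g
  assume e: "e > 0" and g: "continuous_map (top_of_set (cube m \<times> cube 0)) (mtopology_of M) g"
  \<comment> \<open>A fibre is a single point, so \<open>g\<close> itself can be kept.\<close>
  have "cube 0 = {\<lambda>_. 0}" by (auto simp: cube_def)
  then have "mdim_le M (g ` ({z} \<times> cube 0)) 0" for z by (simp add: mdim_le_sing)
  then show "\<exists>g'. eps_homotopic M (cube m \<times> cube 0) e g g' \<and> (\<forall>z\<in>cube m. mdim_le M (g' ` ({z} \<times> cube 0)) 0)"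
    using eps_homotopic_refl[OF g] e by (intro exI[of _ g]) auto
qed

text \<open>The conditions at the scales \<open>1 / Suc j\<close> are open by
  \<open>edim_le_stable\<close> and can be met by \<open>fibre_edim_dense\<close>; a map satisfying
  all of them has fibre images of dimension at most \<open>k + 1\<close>, since these are
  compact.\<close>

lemma FAP_Suc_if_locally:
  assumes M: "mcomplete_of M" and F: "FAP k M"
    and loc: "\<And>y. y \<in> mspace M \<Longrightarrow>
      \<exists>U. U \<subseteq> mspace M \<and> y \<in> (mtopology_of M) interior_of U \<and> FAP (Suc k) (submetric M U)"
  shows "FAP (Suc k) M"
proof (rule FAP_I)
  fix e :: real and m g
  let ?C = "cube m \<times> cube (Suc k)"
  assume e: "e > 0" and g: "continuous_map (top_of_set ?C) (mtopology_of M) g"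
  define Q where "Q j f \<longleftrightarrow> (\<forall>z\<in>cube m. edim_le M (1 / Suc j) (Suc k) (f ` ({z} \<times> cube (Suc k))))" for j f
  have cS: "compact (Sigma (cube m) (\<lambda>z. {z} \<times> cube (Suc k)))"
  proof -
    have "Sigma (cube m) (\<lambda>z. {z} \<times> cube (Suc k)) = (cube m \<times> ?C) \<inter> {w. fst w = fst (snd w)}" by auto
    moreover have "closed {w :: (nat \<Rightarrow> real) \<times> (nat \<Rightarrow> real) \<times> (nat \<Rightarrow> real). fst w = fst (snd w)}"
      by (intro closed_Collect_eq continuous_intros)
    ultimately show ?thesis using compact_cube by (auto intro!: compact_Int_closed compact_Times)
  qed
  have stable: "\<exists>d>0. \<forall>f'. continuous_map (top_of_set ?C) (mtopology_of M) f' \<longrightarrow>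
               (\<forall>x\<in>?C. mdist M (f x) (f' x) \<le> d) \<longrightarrow> Q j f'"
    if "continuous_map (top_of_set ?C) (mtopology_of M) f" "Q j f" for j f
    unfolding Q_def
    by (rule edim_le_stable[OF that(1) compact_cube cS]) (use that(2) in \<open>auto simp: Q_def\<close>)
  have dense: "\<exists>f'. eps_homotopic M ?C e f f' \<and> Q j f'"
    if f: "continuous_map (top_of_set ?C) (mtopology_of M) f" and e: "e > 0" for j f e
  proof -
    have j: "1 / real (Suc j) > 0" by simp
    obtain f' where "eps_homotopic M ?C e f f'"
      "\<And>z. z \<in> cube m \<Longrightarrow> edim_le M (1 / Suc j) (Suc k) (f' ` ({z} \<times> cube (Suc k)))"
      by (rule fibre_edim_dense[OF M F _ e j f]) (erule loc, rule that)
    then show ?thesis unfolding Q_def by blast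
  qed
  obtain f where f: "eps_homotopic M ?C e g f" "\<And>j. Q j f"
    by (rule eps_homotopic_Baire[where Q=Q, OF M stable dense g e]) (assumption | rule that)+
  have "mdim_le M (f ` ({z} \<times> cube (Suc k))) (Suc k)" if z: "z \<in> cube m" for z
  proof (rule edim_le_inverse_Suc_imp_mdim_le)
    show "compactin (mtopology_of M) (f ` ({z} \<times> cube (Suc k)))"
      by (intro compactin_image_top_of_set[OF eps_homotopic_continuous_map(2)[OF f(1)]] compact_Times compact_cube)
         (use z in auto)
  qed (use f(2) z in \<open>auto simp: Q_def\<close>)
  then show "\<exists>g'. eps_homotopic M ?C e g g' \<and> (\<forall>z\<in>cube m. mdim_le M (g' ` ({z} \<times> cube (Suc k))) (Suc k))"
    using f(1) by blast
qed

theorem theorem4p3: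
  fixes M :: "'a metric" and n :: nat
  assumes "mcomplete_of M"
  shows "strong_FAP n M \<longleftrightarrow>
    (\<forall>z\<in>mspace M. \<exists>U. U \<subseteq> mspace M \<and> z \<in> (mtopology_of M) interior_of U \<and>
                        strong_FAP n (submetric M U))"
proof
  assume "strong_FAP n M"
  moreover have "(mtopology_of M) interior_of (mspace M) = mspace M"
    by (metis interior_of_topspace topspace_mtopology_of)
  ultimately show "\<forall>z\<in>mspace M. \<exists>U. U \<subseteq> mspace M \<and> z \<in> (mtopology_of M) interior_of U \<and>
      strong_FAP n (submetric M U)"
    by (intro ballI exI[of _ "mspace M"]) simp
next
  assume L: "\<forall>z\<in>mspace M. \<exists>U. U \<subseteq> mspace M \<and> z \<in> (mtopology_of M) interior_of U \<and>
      strong_FAP n (submetric M U)"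
  \<comment> \<open>Passing from \<open>k\<close> to \<open>Suc k\<close> uses \<open>FAP k\<close>
    of \<open>M\<close> itself but \<open>FAP (Suc k)\<close> only of neighbourhoods, which is
    available up to \<open>n\<close>.\<close>
  have "FAP k M" if "k \<le> n" for k
    using that
  proof (induction k)
    case 0
    show ?case by (rule FAP_0)
  next
    case (Suc k)
    show ?case
    proof (rule FAP_Suc_if_locally[OF assms])
      show "FAP k M" using Suc by simp
      show "\<exists>U. U \<subseteq> mspace M \<and> y \<in> (mtopology_of M) interior_of U \<and> FAP (Suc k) (submetric M U)"
        if "y \<in> mspace M" for y
        using L that Suc.prems unfolding strong_FAP_def by blast
    qed
  qed
  then show "strong_FAP n M" by (simp add: strong_FAP_def)
qed

end
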